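(* Let $K\in\mathcal S^n_o$ and $\varphi\in\Phi$. Then $$\lim_{p\to\infty}\mathrm L_{\varphi^p}K=\mathrm L_\infty K .$$
   Context: Work in $\mathbb R^n$; $V$ is volume, $S$ spherical Lebesgue measure on the unit sphere $S^{n-1}$. $\Phi$ is the class of convex, strictly increasing functions $\varphi:[0,\infty)\to[0,\infty)$ with $\varphi(0)=0$; for $p\ge1$, $\varphi^p$ denotes $t\mapsto\varphi(t)^p$, which is again in $\Phi$. For a compact set $K$ that is star-shaped about the origin, the radial function is $\rho_K(x)=\sup\{\lambda\ge0:\lambda x\in K\}$, $x\ne o$; $\mathcal S^n_o$ is the class of star bodies about the origin $o$, i.e. compact sets $K$ with $\lambda x\in K$ for all $x\in K,\lambda\in[0,1]$, with $o\in\operatorname{int}K$ and $\rho_K$ continuous on $S^{n-1}$. Convergence is with respect to the dual Hausdorff metric $\tilde\delta_H(K_1,K_2)=\max_{u\in S^{n-1}}|\rho_{K_1}(u)-\rho_{K_2}(u)|$. $\mathcal E^n$ is the class of (nondegenerate, $n$-dimensional) origin-symmetric ellipsoids. $V_K^*$ is the probability measure on $S^{n-1}$ with $dV_K^*=\frac{\rho_K^n}{nV(K)}\,dS$. For $K,L\in\mathcal S^n_o$, $$O_\varphi(K,L)=\inf\left\{\lambda>0:\ \varphi^{-1}\left(\int_{S^{n-1}}\varphi\left(\frac{\rho_K}{\lambda\rho_L}\right)dV_K^*\right)\le1\right\}.$$ The Orlicz-Legendre ellipsoid $\mathrm L_\varphi K$ is the unique $E\in\mathcal E^n$ that minimizes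 $V(E)$ subject to $O_\varphi(K,E)\le1$ (it exists and is unique). For a convex body $M$ with the origin in its interior, $M^*=\{x: x\cdot y\le1\ \text{for all } y\in M\}$ is the polar body, and $\mathrm E_\infty M$ is the unique origin-symmetric ellipsoid of maximal volume contained in $M$. For $K\in\mathcal S^n_o$, $\mathrm L_\infty K=\left(\mathrm E_\infty\left((\operatorname{conv}K)^*\right)\right)^*$, where $\operatorname{conv}$ denotes convex hull. *)

theory Defs
  imports "HOL-Analysis.Analysis"
begin

definition Orlicz_class :: "(real \<Rightarrow> real) set" where
  "Orlicz_class = {\<phi>. (\<forall>t\<ge>0. \<phi> t \<ge> 0) \<and> convex_on {0..} \<phi> \<and> strict_mono_on {0..} \<phi> \<and> \<phi> 0 = 0}"

definition radial :: "(real^'n) set \<Rightarrow> real^'n \<Rightarrow> real" where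
  "radial K x = Sup {l. l \<ge> 0 \<and> l *\<^sub>R x \<in> K}"

definition star_bodies :: "(real^'n) set set" where
  "star_bodies = {K. compact K \<and> (\<forall>x\<in>K. \<forall>l\<in>{0..1}. l *\<^sub>R x \<in> K) \<and>
     0 \<in> interior K \<and> continuous_on (sphere 0 1) (radial K)}"

text \<open>On star bodies the supremum over the sphere is a maximum, since radial functions are continuous on the
  compact unit sphere.\<close>

definition dual_Hausdorff_dist :: "(real^'n) set \<Rightarrow> (real^'n) set \<Rightarrow> real" where
  "dual_Hausdorff_dist K L = (SUP u\<in>sphere 0 1. \<bar>radial K u - radial L u\<bar>)"

abbreviation volume :: "(real^'n) set \<Rightarrow> real" where
  "volume \<equiv> measure lebesgue"

definition sym_ellipsoids :: "(real^'n) set set" where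
  "sym_ellipsoids = {f ` cball 0 1 | f :: real^'n \<Rightarrow> real^'n. linear f \<and> inj f}"

text \<open>Spherical Lebesgue measure, given as usual by \<open>n\<close> times the volume of the cone
  \<open>{t u | 0 < t < 1, u \<in> A}\<close> over a Borel set \<open>A\<close> of the sphere; see
  \<open>emeasure_spherical_measure\<close> below.\<close>

definition spherical_measure :: "(real^'n) measure" where
  "spherical_measure = scale_measure (of_nat CARD('n))
     (distr (restrict_space lborel (ball 0 1 - {0})) (restrict_space borel (sphere 0 1))
        (\<lambda>x. x /\<^sub>R norm x))"

lemma radial_projection_measurable:
  "(\<lambda>x::real^'n. x /\<^sub>R norm x)
     \<in> restrict_space lborel (ball 0 1 - {0}) \<rightarrow>\<^sub>M restrict_space borel (sphere 0 1)"
  by (rule measurable_restrict_space2)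
     (auto simp: space_restrict_space intro!: measurable_restrict_space1)

lemma emeasure_spherical_measure:
  fixes A :: "(real^'n) set"
  assumes "A \<in> sets borel" "A \<subseteq> sphere 0 1"
  shows "emeasure spherical_measure A =
    of_nat CARD('n) * emeasure lborel {t *\<^sub>R u | t u. 0 < t \<and> t < 1 \<and> u \<in> A}"
proof -
  have A: "A \<in> sets (restrict_space borel (sphere 0 1))"
    using assms by (auto simp: sets_restrict_space image_iff)
  have eq: "(\<lambda>x. x /\<^sub>R norm x) -` A \<inter> (ball 0 1 - {0})
      = {t *\<^sub>R u | t u. 0 < t \<and> t < 1 \<and> u \<in> A}" (is "?L = ?R")
  proof (intro equalityI subsetI)
    fix x assume x: "x \<in> ?L"
    then have "x = norm x *\<^sub>R (x /\<^sub>R norm x)" "0 < norm x" "norm x < 1" "x /\<^sub>R norm x \<in> A"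
      by auto
    then show "x \<in> ?R" by blast
  next
    fix x assume "x \<in> ?R"
    then obtain t u where "x = t *\<^sub>R u" "0 < t" "t < 1" "u \<in> A" by blast
    moreover from this have "norm u = 1" using assms by auto
    moreover from this have "u \<noteq> 0" by auto
    ultimately show "x \<in> ?L" by auto
  qed
  have "emeasure spherical_measure A = of_nat CARD('n) *
      emeasure (restrict_space lborel (ball 0 1 - {0}))
        ((\<lambda>x. x /\<^sub>R norm x) -` A \<inter> space (restrict_space lborel (ball 0 1 - {0})))"
    unfolding spherical_measure_def emeasure_scale_measure
    by (subst emeasure_distr[OF radial_projection_measurable A]) simp
  also have "space (restrict_space lborel (ball 0 1 - {0})) = (ball 0 1 - {0} :: (real^'n) set)"
    by (simp add: space_restrict_space)
  also have "emeasure (restrict_space lborel (ball 0 1 - {0}))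
      ((\<lambda>x. x /\<^sub>R norm x) -` A \<inter> (ball 0 1 - {0}))
      = emeasure lborel ((\<lambda>x. x /\<^sub>R norm x) -` A \<inter> (ball 0 1 - {0}))"
    by (rule emeasure_restrict_space) auto
  finally show ?thesis unfolding eq .
qed

definition dual_cone_measure :: "(real^'n) set \<Rightarrow> (real^'n) measure" where
  "dual_cone_measure K =
     density spherical_measure (\<lambda>u. ennreal (radial K u ^ CARD('n) / (real CARD('n) * volume K)))"

definition Orlicz_functional ::
    "(real \<Rightarrow> real) \<Rightarrow> (real^'n) set \<Rightarrow> (real^'n) set \<Rightarrow> real" where
  "Orlicz_functional \<phi> K L = Inf {l. l > 0 \<and>
     inv_into {0..} \<phi> (\<integral>u. \<phi> (radial K u / (l * radial L u)) \<partial>dual_cone_measure K) \<le> 1}"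

definition Orlicz_Legendre_ellipsoid ::
    "(real \<Rightarrow> real) \<Rightarrow> (real^'n) set \<Rightarrow> (real^'n) set" where
  "Orlicz_Legendre_ellipsoid \<phi> K = (THE E. E \<in> sym_ellipsoids \<and> Orlicz_functional \<phi> K E \<le> 1 \<and>
     (\<forall>E'\<in>sym_ellipsoids. Orlicz_functional \<phi> K E' \<le> 1 \<longrightarrow> volume E \<le> volume E'))"

definition polar_body :: "(real^'n) set \<Rightarrow> (real^'n) set" where
  "polar_body M = {x. \<forall>y\<in>M. x \<bullet> y \<le> 1}"

definition max_inscribed_ellipsoid :: "(real^'n) set \<Rightarrow> (real^'n) set" where
  "max_inscribed_ellipsoid M = (THE E. E \<in> sym_ellipsoids \<and> E \<subseteq> M \<and>
     (\<forall>E'\<in>sym_ellipsoids. E' \<subseteq> M \<longrightarrow> volume E' \<le> volume E))"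

definition L_infinity_ellipsoid :: "(real^'n) set \<Rightarrow> (real^'n) set" where
  "L_infinity_ellipsoid K = polar_body (max_inscribed_ellipsoid (polar_body (convex hull K)))"

end

theory Submission
  imports Defs
begin

text \<open>Write an origin-symmetric ellipsoid as \<open>E\<^sub>A = {x. \<bar>A x\<bar> \<le> 1}\<close>, so that \<open>1/\<rho>(u) = \<bar>A u\<bar>\<close> and the volume is
  proportional to \<open>1/\<bar>det A\<bar>\<close>. Both \<open>L\<^sub>\<phi> K\<close> and \<open>L\<^sub>\<infinity> K\<close> are then \<open>E\<^sub>A\<close> for a maximiser \<open>A\<close> of \<open>\<bar>det\<bar>\<close> over a
  compact set of matrices, given by \<open>\<integral> \<phi>(\<rho>\<^sub>K \<bar>A u\<bar>) dV\<^sub>K\<^sup>* \<le> \<phi>(1)\<close> and by \<open>K \<subseteq> E\<^sub>A\<close> respectively. Such a maximiser is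
  unique up to the function \<open>\<bar>A x\<bar>\<close>: averaging two of them, after a rotation which makes them simultaneously
  diagonal, increases the determinant. The integral constraints for \<open>\<phi>\<^sup>p\<close> are weaker than \<open>K \<subseteq> E\<^sub>A\<close> because
  \<open>V\<^sub>K\<^sup>*\<close> has mass at most one, they bound \<open>A\<close> uniformly in \<open>p\<close>, and a limit of matrices satisfying them as
  \<open>p \<rightarrow> \<infinity>\<close> satisfies \<open>K \<subseteq> E\<^sub>A\<close>; so every limit point of maximisers is a maximiser for \<open>L\<^sub>\<infinity> K\<close>.\<close>

section \<open>Determinants of averaged matrices\<close>

text \<open>Both ellipsoids are introduced by \<open>THE\<close>, so existence and uniqueness of the
  extremal ellipsoid must come before any limit; one determinant argument serves both. A matrix is
  determined by its ellipsoid only up to an orthogonal factor on the left, and the linear mean of A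
  and -A is singular. Hence matrices are compared through the functions |A x|, and the convexity
  used is that of the constraints in terms of these functions. The detour through polar bodies in
  \<open>L_infinity_ellipsoid\<close> disappears on transposing: a maximal ellipsoid inside the
  polar of conv K is the polar of a minimal ellipsoid around K. The constraint sets for different p
  are never compared with each other. Each contains the enclosing matrices, which bounds the
  determinants of the maximisers from below, so that a limit of maximisers is nonsingular and at
  least as good as the best enclosing matrix. Two facts about the measure carry the estimates: its
  mass is at most one, and it charges every nonempty relatively open part of the sphere.\<close>

lemma selfadjoint_maximizer_eigenvector:
  fixes f :: "'a::euclidean_space \<Rightarrow> 'a"
  assumes f: "linear f" "\<And>x y. f x \<bullet> y = x \<bullet> f y"
    and S: "subspace S" "f ` S \<subseteq> S" and v: "v \<in> S" "norm v = 1"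
    and max: "\<And>x. x \<in> S \<Longrightarrow> norm x = 1 \<Longrightarrow> x \<bullet> f x \<le> v \<bullet> f v"
  shows "f v = (v \<bullet> f v) *\<^sub>R v"
proof -
  define c w where "c = v \<bullet> f v" and "w = f v - c *\<^sub>R v"
  have wS: "w \<in> S"
    using S v unfolding w_def by (intro subspace_diff subspace_scale) auto
  have vv: "v \<bullet> v = 1" using v by (simp add: dot_square_norm)
  have wv: "w \<bullet> v = 0" by (simp add: w_def inner_diff_left c_def vv inner_commute[of "f v"])
  have wfv: "w \<bullet> f v = w \<bullet> w"
    using wv by (simp add: w_def inner_diff_right)
  have bound: "x \<bullet> f x \<le> c * (x \<bullet> x)" if "x \<in> S" for x
  proof (cases "x = 0")
    case False
    have "(x /\<^sub>R norm x) \<bullet> f (x /\<^sub>R norm x) \<le> c"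
      unfolding c_def using that False S by (intro max) (auto intro: subspace_scale)
    then have "(x \<bullet> f x) / (norm x)\<^sup>2 \<le> c"
      by (simp add: linear_scale[OF f(1)] power2_eq_square divide_inverse mult_ac)
    with False show ?thesis
      by (simp add: divide_le_eq dot_square_norm mult.commute)
  qed (simp add: linear_0[OF f(1)])
  \<comment> \<open>First-order condition at the maximiser: the residual \<open>w\<close> is
    orthogonal to \<open>v\<close>, so moving from \<open>v\<close> to \<open>v + t w\<close> raises
    the quadratic form by 2t |w|^2 to first order, while the bound leaves room only of order t^2.
    Dividing by t and letting t tend to 0 from the right forces \<open>w = 0\<close>.\<close>
  have key: "2 * (w \<bullet> w) \<le> t * (c * (w \<bullet> w) - w \<bullet> f w)" if "t > 0" for t
  proof -
    have "(v + t *\<^sub>R w) \<bullet> f (v + t *\<^sub>R w) \<le> c * ((v + t *\<^sub>R w) \<bullet> (v + t *\<^sub>R w))"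
      using S v wS by (intro bound subspace_add subspace_scale)
    moreover have "(v + t *\<^sub>R w) \<bullet> f (v + t *\<^sub>R w) = c + 2 * t * (w \<bullet> w) + t * t * (w \<bullet> f w)"
      using wfv f(2)[of v w] by (simp add: linear_add[OF f(1)] linear_scale[OF f(1)]
          inner_add_left inner_add_right c_def inner_commute algebra_simps)
    moreover have "(v + t *\<^sub>R w) \<bullet> (v + t *\<^sub>R w) = 1 + t * t * (w \<bullet> w)"
      using wv vv by (simp add: inner_add_left inner_add_right inner_commute)
    ultimately have "c + 2 * t * (w \<bullet> w) + t * t * (w \<bullet> f w) \<le> c * (1 + t * t * (w \<bullet> w))"
      by (simp only:)
    then have "t * (2 * (w \<bullet> w)) \<le> t * (t * (c * (w \<bullet> w) - w \<bullet> f w))"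
      by (simp add: algebra_simps)
    with that show ?thesis by (simp only: mult_le_cancel_left_pos)
  qed
  have "((\<lambda>t. t * (c * (w \<bullet> w) - w \<bullet> f w)) \<longlongrightarrow> 0 * (c * (w \<bullet> w) - w \<bullet> f w)) (at_right 0)"
    by (intro tendsto_intros)
  then have "2 * (w \<bullet> w) \<le> 0"
    using key by (intro tendsto_le[OF _ _ tendsto_const, of "at_right 0"])
      (auto simp: eventually_at_right_less intro: eventually_at_rightI[of 0 1])
  then have "w = 0" by (metis inner_ge_zero inner_eq_zero_iff mult_le_0_iff not_numeral_le_zero antisym)
  then show ?thesis by (simp add: w_def c_def)
qed

text \<open>A maximiser of the quadratic form on the unit sphere of S is an eigenvector, and its
  orthogonal complement in S is again invariant and of smaller dimension. The statement is about
  invariant subspaces, not the whole space, so that this induction closes.\<close>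

lemma selfadjoint_orthonormal_eigenbasis:
  fixes f :: "'a::euclidean_space \<Rightarrow> 'a"
  assumes f: "linear f" "\<And>x y. f x \<bullet> y = x \<bullet> f y"
    and "subspace S" "f ` S \<subseteq> S"
  obtains B where "B \<subseteq> S" "pairwise orthogonal B" "\<And>b. b \<in> B \<Longrightarrow> norm b = 1"
    "\<And>b. b \<in> B \<Longrightarrow> \<exists>c. f b = c *\<^sub>R b" "span B = S"
proof -
  have "\<exists>B\<subseteq>S. pairwise orthogonal B \<and> (\<forall>b\<in>B. norm b = 1 \<and> (\<exists>c. f b = c *\<^sub>R b)) \<and> span B = S"
    using assms(3,4)
  proof (induction "dim S" arbitrary: S rule: less_induct)
    case less
    show ?case
    proof (cases "S = {0}")
      case True
      then show ?thesis by (intro exI[of _ "{}"]) auto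
    next
      case False
      then obtain z where z: "z \<in> S" "z \<noteq> 0" using less.prems subspace_0 by blast
      have "compact (S \<inter> sphere 0 1)"
        using less.prems closed_subspace by (intro closed_Int_compact) auto
      moreover have "z /\<^sub>R norm z \<in> S \<inter> sphere 0 1"
        using z less.prems by (auto intro: subspace_scale)
      moreover have "continuous_on (S \<inter> sphere 0 1) (\<lambda>x. x \<bullet> f x)"
        using f(1) by (intro continuous_intros linear_continuous_on) (simp add: linear_linear)
      ultimately obtain v where v: "v \<in> S" "norm v = 1"
        and "\<And>x. x \<in> S \<Longrightarrow> norm x = 1 \<Longrightarrow> x \<bullet> f x \<le> v \<bullet> f v"
        using continuous_attains_sup[of "S \<inter> sphere 0 1" "\<lambda>x. x \<bullet> f x"]
        by (metis Int_iff empty_iff mem_sphere_0)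
      then obtain c where c: "f v = c *\<^sub>R v"
        using selfadjoint_maximizer_eigenvector[OF f less.prems] by blast
      define T where "T = {x \<in> S. x \<bullet> v = 0}"
      have T: "subspace T" "f ` T \<subseteq> T"
        using less.prems by (auto simp: T_def subspace_def inner_add_left f c)
      have vv: "v \<bullet> v = 1" using v by (simp add: dot_square_norm)
      have "v \<notin> T" "T \<subseteq> S" using vv by (auto simp: T_def)
      then have "span T \<subset> span S" using T less.prems v by (metis psubsetI span_eq_iff)
      then have "dim T < dim S" by (rule dim_psubset)
      from less.hyps[OF this T] obtain B where B: "B \<subseteq> T" "pairwise orthogonal B"
        "\<forall>b\<in>B. norm b = 1 \<and> (\<exists>c. f b = c *\<^sub>R b)" "span B = T" by blast
      have "x \<in> span (insert v B)" if "x \<in> S" for x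
      proof -
        have "x - (x \<bullet> v) *\<^sub>R v \<in> T"
          using that v less.prems vv
          by (auto simp: T_def inner_diff_left intro: subspace_diff subspace_scale)
        then show ?thesis
          using B(4) by (auto simp: span_insert)
      qed
      moreover have "span (insert v B) \<subseteq> S"
        using B(1) v \<open>T \<subseteq> S\<close> less.prems by (intro span_minimal) auto
      ultimately have "span (insert v B) = S" by blast
      moreover have "pairwise orthogonal (insert v B)"
        using B(1,2) by (auto simp: pairwise_insert T_def orthogonal_def inner_commute)
      ultimately show ?thesis
        using B v c \<open>T \<subseteq> S\<close> by (intro exI[of _ "insert v B"]) auto
    qed
  qed
  with that show thesis by blast
qed

lemma inner_matrix_vector_transpose:
  fixes A :: "real^'n^'n"
  shows "(A *v x) \<bullet> y = x \<bullet> (transpose A *v y)"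
  by (metis dot_lmul_matrix inner_commute transpose_matrix_vector)

text \<open>The eigenvectors are the rows of \<open>Q\<close>, so \<open>Q *v y\<close> lists the
  coordinates of y in the eigenbasis.\<close>

lemma symmetric_matrix_diagonalization:
  fixes S :: "real^'n^'n"
  assumes "transpose S = S"
  obtains Q d where "orthogonal_matrix Q" "Q ** S ** transpose Q = (\<chi> i j. if i = j then d i else 0)"
proof -
  obtain B where B: "pairwise orthogonal B" "\<And>b. b \<in> B \<Longrightarrow> norm b = 1"
    "\<And>b. b \<in> B \<Longrightarrow> \<exists>c. S *v b = c *\<^sub>R b" "span B = UNIV"
    by (rule selfadjoint_orthonormal_eigenbasis[of "\<lambda>x. S *v x" UNIV])
      (auto simp: inner_matrix_vector_transpose assms)
  have "0 \<notin> B" using B(2) by force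
  then have ind: "independent B" using B(1) pairwise_orthogonal_independent by blast
  then have "card B = CARD('n)" using B(4) by (metis dim_UNIV dim_eq_card_independent dim_span DIM_cart DIM_real mult.right_neutral)
  moreover have "finite B" using ind independent_imp_finite by blast
  ultimately obtain b where b: "bij_betw b (UNIV :: 'n set) B"
    using finite_same_card_bij[of "UNIV :: 'n set" B] by auto
  then have bB: "b i \<in> B" for i by (auto simp: bij_betw_def)
  obtain d where d: "\<And>i. S *v b i = d i *\<^sub>R b i" using B(3)[OF bB] by metis
  have orth: "b i \<bullet> b j = (if i = j then 1 else 0)" for i j
  proof (cases "i = j")
    case False
    then have "b i \<noteq> b j" using b by (auto simp: bij_betw_def inj_on_def)
    then show ?thesis using B(1) bB False by (auto simp: pairwise_def orthogonal_def)
  qed (use B(2) bB in \<open>simp add: dot_square_norm\<close>)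
  define Q where "Q = (\<chi> i. b i)"
  have "orthogonal_matrix Q"
    unfolding orthogonal_matrix_orthonormal_rows Q_def row_def orthogonal_def
    by (auto simp: orth norm_eq_sqrt_inner)
  moreover have "Q ** S ** transpose Q = (\<chi> i j. if i = j then d i else 0)"
  proof -
    have "(Q ** (S ** transpose Q)) $ i $ j = b i \<bullet> (S *v b j)" for i j
      by (simp add: Q_def matrix_matrix_mult_def transpose_def matrix_vector_mult_def inner_vec_def)
    then show ?thesis
      by (simp add: vec_eq_iff matrix_mul_assoc d orth)
  qed
  ultimately show thesis using that by blast
qed

lemma diagonal_matrix_vector_mult:
  fixes y :: "real^'n"
  shows "((\<chi> i j. if i = j then g i else 0) *v y) $ i = g i * y $ i"
  by (simp add: matrix_vector_mult_def if_distrib[of "\<lambda>z. z * _"] cong: if_cong)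

text \<open>The AM-GM inequality ((1 + x)/2)^2 >= x is strict unless x = 1. Multiplying over all
  indices gives a product whose square exceeds 1.\<close>

lemma prod_one_plus_half_gt:
  fixes s :: "'a \<Rightarrow> real"
  assumes "finite I" "\<And>i. i \<in> I \<Longrightarrow> s i > 0" "(\<Prod>i\<in>I. s i) = 1" "k \<in> I" "s k \<noteq> 1"
  shows "(\<Prod>i\<in>I. (1 + s i) / 2) > 1"
proof -
  have sq: "((1 + x) / 2)\<^sup>2 \<ge> x" for x :: real
    using zero_le_power2[of "1 - x"] by (simp add: power2_eq_square field_simps)
  have "(1 - s k)\<^sup>2 > 0" using assms by simp
  then have sqk: "((1 + s k) / 2)\<^sup>2 > s k"
    by (simp add: power2_eq_square field_simps)
  have pos: "0 < ((1 + s i) / 2)\<^sup>2" if "i \<in> I" for i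
    using assms(2)[OF that] by (intro zero_less_power) simp
  have "(\<Prod>i\<in>I. s i) < (\<Prod>i\<in>I. ((1 + s i) / 2)\<^sup>2)"
    proof (rule prod_mono_strict[of k])
    show "0 \<le> s i \<and> s i \<le> ((1 + s i) / 2)\<^sup>2" if "i \<in> I" for i
      using assms(2)[OF that] sq by simp
  qed (use pos assms(1,4) sqk in blast)+
  then have "1 < (\<Prod>i\<in>I. (1 + s i) / 2)\<^sup>2"
    using assms(3) by (simp add: prod_power_distrib)
  moreover have "0 \<le> (\<Prod>i\<in>I. (1 + s i) / 2)"
    by (intro prod_nonneg) (use assms(2) in fastforce)
  ultimately show ?thesis by (metis one_power2 power_less_imp_less_base)
qed

text \<open>Diagonalising \<open>M\<^sup>T M\<close> for \<open>M = B A\<^sup>-\<^sup>1\<close> gives \<open>\<bar>A x\<bar> = \<bar>Q A x\<bar>\<close> and \<open>\<bar>B x\<bar> = \<bar>D Q A x\<bar>\<close>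
  with \<open>Q\<close> orthogonal and \<open>D\<close> positive diagonal, so that \<open>C = (I + D) Q A / 2\<close> works by AM-GM.\<close>

lemma matrix_mean_det_gt:
  fixes A B :: "real^'n^'n"
  assumes A: "det A \<noteq> 0" and AB: "\<bar>det B\<bar> = \<bar>det A\<bar>" and ne: "\<exists>x. norm (A *v x) \<noteq> norm (B *v x)"
  obtains C where "\<And>x. norm (C *v x) \<le> (norm (A *v x) + norm (B *v x)) / 2" "\<bar>det C\<bar> > \<bar>det A\<bar>"
proof -
  obtain A' where inv: "A' ** A = mat 1"
    using A by (auto simp: invertible_def simp flip: invertible_det_nz)
  define M where "M = B ** A'"
  then have MA: "M ** A = B" by (simp add: M_def inv flip: matrix_mul_assoc)
  then have detM: "\<bar>det M\<bar> = 1" using A AB by (metis abs_mult det_mul mult_cancel_right2 abs_eq_0)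
  obtain Q d where Q: "orthogonal_matrix Q"
    and Qd: "Q ** (transpose M ** M) ** transpose Q = (\<chi> i j. if i = j then d i else 0)" (is "_ = ?Dd")
    by (rule symmetric_matrix_diagonalization[of "transpose M ** M"])
      (auto simp: matrix_transpose_mul)
  have QQ: "transpose Q ** Q = mat 1" "Q ** transpose Q = mat 1"
    using Q by (auto simp: orthogonal_matrix_def)
  \<comment> \<open>In the coordinates y = Q A x the form |B x|^2 becomes diagonal with entries
    \<open>d i\<close>; their square roots \<open>s i\<close> are the diagonal of
    \<open>D\<close>.\<close>
  have norm_M: "(norm (M *v (transpose Q *v y)))\<^sup>2 = (\<Sum>i\<in>UNIV. d i * (y $ i)\<^sup>2)" for y
  proof -
    have "(norm (M *v (transpose Q *v y)))\<^sup>2 = y \<bullet> ((Q ** (transpose M ** M) ** transpose Q) *v y)"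
      unfolding power2_norm_eq_inner inner_matrix_vector_transpose transpose_transpose
        matrix_vector_mul_assoc
      by (simp only: matrix_mul_assoc matrix_transpose_mul transpose_transpose)
    also have "\<dots> = (\<Sum>i\<in>UNIV. d i * (y $ i)\<^sup>2)"
      by (simp add: Qd inner_vec_def diagonal_matrix_vector_mult power2_eq_square mult_ac)
    finally show ?thesis .
  qed
  have d_pos: "d k > 0" for k
  proof -
    have "det (M ** transpose Q) \<noteq> 0"
      using detM Q det_orthogonal_matrix[OF Q] by (auto simp: det_mul)
    then have "(M ** transpose Q) *v axis k 1 \<noteq> 0"
      by (metis axis_eq_0_iff invertible_det_nz invertible_eq_bij inj_def bij_is_inj matrix_vector_mult_0_right zero_neq_one)
    then have "0 < (norm (M *v (transpose Q *v axis k 1)))\<^sup>2"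
      unfolding matrix_vector_mul_assoc by simp
    also have "\<dots> = d k"
      unfolding norm_M by (simp add: axis_def if_distrib[of "\<lambda>z. _ * z"] if_distrib[of "\<lambda>z. z\<^sup>2"] cong: if_cong)
    finally show ?thesis .
  qed
  define s where "s i = sqrt (d i)" for i
  define D E :: "real^'n^'n" where "D = (\<chi> i j. if i = j then s i else 0)"
    and "E = (\<chi> i j. if i = j then (1 + s i) / 2 else 0)"
  have s_pos: "s i > 0" and s_sq: "(s i)\<^sup>2 = d i" for i
    using d_pos[of i] by (auto simp: s_def)
  have norm_B: "norm (D *v (Q *v (A *v x))) = norm (B *v x)" for x
  proof -
    have "B *v x = M *v (transpose Q *v (Q *v (A *v x)))"
      using MA by (simp add: matrix_vector_mul_assoc QQ flip: matrix_mul_assoc)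
        (metis QQ(1) matrix_mul_assoc matrix_mul_lid)
    then have "(norm (B *v x))\<^sup>2 = (\<Sum>i\<in>UNIV. d i * ((Q *v (A *v x)) $ i)\<^sup>2)"
      by (simp only: norm_M)
    also have "\<dots> = (norm (D *v (Q *v (A *v x))))\<^sup>2"
      unfolding D_def power2_norm_eq_inner[of "_ *v _"] inner_vec_def diagonal_matrix_vector_mult
      by (intro sum.cong) (simp_all add: power2_eq_square flip: s_sq)
    finally show ?thesis by simp
  qed
  have norm_A: "norm (Q *v y) = norm y" for y
  proof -
    have "(Q *v y) \<bullet> (Q *v y) = y \<bullet> y"
      unfolding inner_matrix_vector_transpose matrix_vector_mul_assoc QQ by simp
    then show ?thesis by (simp add: norm_eq_sqrt_inner)
  qed
  \<comment> \<open>The equality of |det A| and |det B| enters here: it gives |det M| = 1, which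
    normalises the product of the \<open>s i\<close> to 1.\<close>
  have det_s: "(\<Prod>i\<in>UNIV. s i) = 1"
  proof -
    have "det (Q ** (transpose M ** M) ** transpose Q) = (det Q)\<^sup>2 * (det M)\<^sup>2"
      by (simp add: det_mul det_transpose power2_eq_square)
    also have "\<dots> = 1"
      using detM det_orthogonal_matrix[OF Q] by (auto simp: abs_if split: if_splits)
    finally have "(\<Prod>i\<in>UNIV. d i) = 1" unfolding Qd by (subst (asm) det_diagonal) auto
    then have "(\<Prod>i\<in>UNIV. s i)\<^sup>2 = 1"
      by (simp add: prod_power_distrib s_sq)
    then show ?thesis
      using prod_pos[of UNIV s] s_pos by (auto simp: power2_eq_1_iff)
  qed
  \<comment> \<open>If every \<open>s i\<close> were 1, then \<open>D\<close> would be the identity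
    and |A x| = |B x| for all x, contrary to \<open>ne\<close>.\<close>
  have "\<exists>k. s k \<noteq> 1"
  proof (rule ccontr)
    assume "\<not> ?thesis"
    then have "D = mat 1" by (simp add: D_def mat_def vec_eq_iff)
    then show False using ne norm_A norm_B by simp
  qed
  then have det_E: "det E > 1"
    unfolding E_def using prod_one_plus_half_gt[of UNIV s] s_pos det_s by (subst det_diagonal) auto
  define C where "C = E ** Q ** A"
  have "norm (C *v x) \<le> (norm (A *v x) + norm (B *v x)) / 2" for x
  proof -
    define y where "y = Q *v (A *v x)"
    have "C *v x = (1/2) *\<^sub>R (y + D *v y)"
      by (simp add: C_def vec_eq_iff D_def diagonal_matrix_vector_mult E_def y_def field_simps
          matrix_vector_mul_assoc[symmetric])
    then have "norm (C *v x) \<le> (norm y + norm (D *v y)) / 2"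
      using norm_triangle_ineq[of y "D *v y"] by simp
    then show ?thesis by (simp add: y_def norm_A norm_B)
  qed
  moreover have "\<bar>det C\<bar> > \<bar>det A\<bar>"
    using det_E A det_orthogonal_matrix[OF Q] by (auto simp: C_def det_mul abs_mult)
  ultimately show thesis using that by blast
qed

section \<open>Maximisers of the determinant\<close>

lemma continuous_on_det: "continuous_on S (det :: real^'n^'n \<Rightarrow> real)"
  unfolding det_def by (intro continuous_intros)

text \<open>Convexity phrased through the functions |A x|. It has to be stable under every C
  dominated by the mean of two such functions, because the C with larger determinant from
  \<open>matrix_mean_det_gt\<close> is not the linear mean of A and B.\<close>

definition mean_closed :: "(real^'n^'n) set \<Rightarrow> bool" where
  "mean_closed \<A> \<longleftrightarrow> (\<forall>A\<in>\<A>. \<forall>B\<in>\<A>. \<forall>C.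
     (\<forall>x. norm (C *v x) \<le> (norm (A *v x) + norm (B *v x)) / 2) \<longrightarrow> C \<in> \<A>)"

definition max_det :: "(real^'n^'n) set \<Rightarrow> real^'n^'n \<Rightarrow> bool" where
  "max_det \<A> A \<longleftrightarrow> A \<in> \<A> \<and> det A \<noteq> 0 \<and> (\<forall>B\<in>\<A>. \<bar>det B\<bar> \<le> \<bar>det A\<bar>)"

lemma max_det_exists:
  assumes "compact \<A>" "A0 \<in> \<A>" "det A0 \<noteq> 0"
  obtains A where "max_det \<A> A"
proof -
  obtain A where A: "A \<in> \<A>" "\<And>B. B \<in> \<A> \<Longrightarrow> \<bar>det B\<bar> \<le> \<bar>det A\<bar>"
    using continuous_attains_sup[of \<A> "\<lambda>A. \<bar>det A\<bar>"] assms
      continuous_on_rabs[OF continuous_on_det[of \<A>]] by blast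
  with assms that show thesis unfolding max_det_def by fastforce
qed

text \<open>Two competitors with different norm functions would have an average in the set with a
  strictly larger determinant. Asking only that |det B| is at least |det A| allows the lemma to be
  applied to a limit of maximisers of other sets.\<close>

lemma max_det_unique:
  assumes "mean_closed \<A>" "max_det \<A> A" "B \<in> \<A>" "\<bar>det A\<bar> \<le> \<bar>det B\<bar>"
  shows "norm (B *v x) = norm (A *v x)"
proof (rule ccontr)
  assume "norm (B *v x) \<noteq> norm (A *v x)"
  moreover have "det A \<noteq> 0" "\<bar>det B\<bar> = \<bar>det A\<bar>" using assms by (auto simp: max_det_def intro: antisym)
  ultimately obtain C where "\<And>x. norm (C *v x) \<le> (norm (A *v x) + norm (B *v x)) / 2" "\<bar>det C\<bar> > \<bar>det A\<bar>"
    using matrix_mean_det_gt[of A B] by metis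
  with assms show False unfolding mean_closed_def max_det_def by (metis not_le)
qed

section \<open>Ellipsoids as unit balls of matrix norms\<close>

definition norm_ellipsoid :: "real^'n^'n \<Rightarrow> (real^'n) set" where
  "norm_ellipsoid A = {x. norm (A *v x) \<le> 1}"

lemma det_nz_inverse:
  fixes A :: "real^'n^'n"
  assumes "det A \<noteq> 0"
  obtains A' where "A ** A' = mat 1" "A' ** A = mat 1"
  using assms by (auto simp: invertible_def simp flip: invertible_det_nz)

lemma det_nz_norm_pos:
  fixes A :: "real^'n^'n"
  assumes "det A \<noteq> 0" "x \<noteq> 0"
  shows "norm (A *v x) > 0"
proof -
  obtain A' where "A' ** A = mat 1" using det_nz_inverse assms(1) by blast
  then have "A' *v (A *v x) = x" by (simp add: matrix_vector_mul_assoc)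
  with assms(2) show ?thesis by (metis matrix_vector_mult_0_right zero_less_norm_iff)
qed

lemma norm_ellipsoid_eq_image:
  fixes A A' :: "real^'n^'n"
  assumes "A ** A' = mat 1"
  shows "norm_ellipsoid A = (*v) A' ` cball 0 1"
proof -
  have "A' ** A = mat 1" using assms matrix_left_right_inverse by blast
  then have *: "A *v (A' *v x) = x" "A' *v (A *v x) = x" for x
    using assms by (auto simp: matrix_vector_mul_assoc)
  show ?thesis
  proof (intro equalityI subsetI)
    fix x assume "x \<in> norm_ellipsoid A"
    then have "A *v x \<in> cball 0 1" by (simp add: norm_ellipsoid_def)
    then show "x \<in> (*v) A' ` cball 0 1" using *(2) by (metis image_eqI)
  qed (auto simp: norm_ellipsoid_def *)
qed

lemma matrix_image_sym_ellipsoid: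
  fixes A :: "real^'n^'n"
  assumes "det A \<noteq> 0"
  shows "(*v) A ` cball 0 1 \<in> sym_ellipsoids"
proof -
  have "inj ((*v) A)"
    using assms by (metis bij_is_inj invertible_det_nz invertible_eq_bij)
  then show ?thesis unfolding sym_ellipsoids_def by (intro CollectI exI[of _ "(*v) A"]) auto
qed

lemma sym_ellipsoid_matrix_image:
  fixes E :: "(real^'n) set"
  assumes "E \<in> sym_ellipsoids"
  obtains A where "det A \<noteq> 0" "E = (*v) A ` cball 0 1"
proof -
  obtain f :: "real^'n \<Rightarrow> real^'n" where f: "linear f" "inj f" "E = f ` cball 0 1"
    using assms unfolding sym_ellipsoids_def by blast
  then have "det (matrix f) \<noteq> 0" "f = (*v) (matrix f)"
    using det_nz_iff_inj matrix_vector_mul(1) by auto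
  with f(3) that show thesis by metis
qed

lemma norm_ellipsoid_sym_ellipsoid:
  fixes A :: "real^'n^'n"
  assumes "det A \<noteq> 0"
  shows "norm_ellipsoid A \<in> sym_ellipsoids"
proof -
  obtain A' where A': "A ** A' = mat 1" using assms det_nz_inverse by blast
  then have "det A' \<noteq> 0" by (metis det_I det_mul mult_zero_right zero_neq_one)
  then show ?thesis using matrix_image_sym_ellipsoid norm_ellipsoid_eq_image[OF A'] by simp
qed

lemma sym_ellipsoid_norm_ellipsoid:
  fixes E :: "(real^'n) set"
  assumes "E \<in> sym_ellipsoids"
  obtains A where "det A \<noteq> 0" "E = norm_ellipsoid A"
proof -
  obtain A' where A': "det A' \<noteq> 0" "E = (*v) A' ` cball 0 1"
    using sym_ellipsoid_matrix_image[OF assms] .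
  then obtain A where A: "A ** A' = mat 1" using det_nz_inverse by blast
  then have "det A \<noteq> 0" by (metis det_I det_mul mult_zero_left zero_neq_one)
  with A A'(2) norm_ellipsoid_eq_image that show thesis by blast
qed

text \<open>The library has this only for well-ordered index types, where determinants of shears are
  computed from triangular matrices.\<close>

proposition measure_linear_image_cart:
  fixes f :: "real^'n \<Rightarrow> real^'n"
  assumes "linear f" "S \<in> lmeasurable"
  shows "f ` S \<in> lmeasurable \<and> measure lebesgue (f ` S) = \<bar>det (matrix f)\<bar> * measure lebesgue S"
proof -
  define P where "P f \<longleftrightarrow> (\<forall>S\<in>lmeasurable. f ` S \<in> lmeasurable \<and>
    measure lebesgue (f ` S) = \<bar>det (matrix f)\<bar> * measure lebesgue S)" for f :: "real^'n \<Rightarrow> real^'n"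
  \<comment> \<open>For a linear map with determinant 1 or -1 it suffices to see that volumes of
    boxes are preserved. Coordinate swaps and shears are settled in this way.\<close>
  have intervals: "P f" if "linear f" "\<bar>det (matrix f)\<bar> = 1"
    "\<And>a b. cbox a b \<noteq> {} \<Longrightarrow> measure lebesgue (f ` cbox a b) = measure lebesgue (cbox a b)" for f
  proof -
    have "measure lebesgue (f ` cbox a b) = 1 * measure lebesgue (cbox a b)" for a b
    proof (cases "cbox a b = {}")
      case False
      then show ?thesis unfolding mult_1 by (rule that(3))
    qed simp
    then have "f ` S \<in> lmeasurable \<and> 1 * measure lebesgue S = measure lebesgue (f ` S)"
      if "S \<in> lmeasurable" for S
      using measure_linear_sufficient \<open>linear f\<close> that by blast
    then show ?thesis
      unfolding P_def that(2) mult_1 by metis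
  qed
  have "P f"
    using assms(1)
  proof (rule induct_linear_elementary)
    fix f g assume "linear f" "linear g" "P f" "P g"
    then show "P (f \<circ> g)"
      unfolding P_def image_comp[symmetric] by (simp add: matrix_compose det_mul abs_mult)
  next
    fix f :: "real^'n \<Rightarrow> real^'n" and i assume f: "linear f" "\<And>x. f x $ i = 0"
    then have "\<not> inj f"
      by (metis linear_injective_imp_surjective one_neq_zero surjE vec_component)
    moreover have "negligible (f ` S)" for S
      using negligible_linear_singular_image[OF f(1) \<open>\<not> inj f\<close>] .
    ultimately show "P f"
      using f(1) det_nz_iff_inj unfolding P_def by (auto simp: negligible_iff_measure)
  next
    fix c :: "'n \<Rightarrow> real"
    have "matrix (\<lambda>x::real^'n. \<chi> i. c i * x $ i) = (\<chi> i j. if i = j then c i else 0)"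
      by (auto simp: matrix_def axis_def vec_eq_iff)
    then show "P (\<lambda>x. \<chi> i. c i * x $ i)"
      unfolding P_def by (auto simp: measurable_stretch measure_stretch det_diagonal)
  next
    fix m n :: 'n assume "m \<noteq> n"
    let ?\<tau> = "Transposition.transpose m n" and ?h = "\<lambda>x::real^'n. \<chi> i. x $ Transposition.transpose m n i"
    show "P ?h"
    proof (rule intervals)
      show "linear ?h" by (rule linearI) (simp_all add: vec_eq_iff)
      have "matrix ?h = (\<chi> i. mat 1 $ ?\<tau> i)"
        by (auto simp: matrix_def axis_def mat_def vec_eq_iff)
      then show "\<bar>det (matrix ?h)\<bar> = 1"
        by (simp add: det_permute_rows permutes_swap_id abs_mult sign_def)
      fix a b :: "real^'n" assume ne: "cbox a b \<noteq> {}"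
      have hh: "?h (?h x) = x" for x by (simp add: vec_eq_iff)
      have h_cbox: "?h x \<in> cbox (?h a) (?h b)" if "x \<in> cbox a b" for x a b
        using that by (simp add: mem_box_cart)
      have img: "?h ` cbox a b = cbox (?h a) (?h b)"
      proof (intro equalityI subsetI)
        fix x assume "x \<in> cbox (?h a) (?h b)"
        then have "?h x \<in> cbox a b" using h_cbox[of x "?h a" "?h b"] by (simp only: hh)
        then have "?h (?h x) \<in> ?h ` cbox a b" by (rule imageI)
        then show "x \<in> ?h ` cbox a b" by (simp only: hh)
      qed (auto intro: h_cbox)
      then have "cbox (?h a) (?h b) \<noteq> {}" using ne by blast
      then show "measure lebesgue (?h ` cbox a b) = measure lebesgue (cbox a b)"
        using ne prod.permute[OF permutes_swap_id[of m UNIV n], of "\<lambda>i. b $ i - a $ i"]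
        by (simp only: img measure_completion sets_lborel cbox_borel)
          (simp add: content_cbox_cart o_def)
    qed
  next
    fix m n :: 'n assume mn: "m \<noteq> n"
    let ?h = "\<lambda>x::real^'n. \<chi> i. if i = m then x $ m + x $ n else x $ i"
    show "P ?h"
    proof (rule intervals)
      show lin: "linear ?h" by (rule linearI) (auto simp: vec_eq_iff algebra_simps)
      have "matrix ?h = (\<chi> k. if k = m then row m (mat 1) + 1 *s row n (mat 1) else row k (mat 1))"
        by (auto simp: matrix_def axis_def mat_def row_def vec_eq_iff)
      then show "\<bar>det (matrix ?h)\<bar> = 1"
        by (simp only: det_row_operation[OF mn] det_I abs_one)
      fix a b :: "real^'n" assume ne: "cbox a b \<noteq> {}"
      \<comment> \<open>This translation moves the box so that its lower n-th coordinate is 0, which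
        gives the sign condition on that coordinate in \<open>measure_shear_interval\<close>.
        Translations do not affect volume.\<close>
      define w where "w = axis n (- a $ n)"
      have "?h ` cbox (w + a) (w + b) = (+) (?h w) ` (?h ` cbox a b)"
        by (simp only: cbox_translation image_image linear_add[OF lin])
      then have "measure lebesgue (?h ` cbox a b) = measure lebesgue (?h ` cbox (w + a) (w + b))"
        by (simp only: measure_translation)
      also have "\<dots> = measure lebesgue (cbox (w + a) (w + b))"
        using ne mn by (intro measure_shear_interval) (auto simp: w_def cbox_translation)
      also have "\<dots> = measure lebesgue (cbox a b)"
        by (simp only: cbox_translation measure_translation)
      finally show "measure lebesgue (?h ` cbox a b) = measure lebesgue (cbox a b)" .
    qed
  qed
  with assms(2) show ?thesis unfolding P_def by blast
qed

lemma volume_matrix_image: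
  fixes A :: "real^'n^'n"
  shows "volume ((*v) A ` cball 0 1) = \<bar>det A\<bar> * volume (cball 0 1 :: (real^'n) set)"
  using measure_linear_image_cart[of "(*v) A" "cball 0 1"] by (simp add: matrix_of_matrix_vector_mul)

lemma volume_norm_ellipsoid:
  fixes A :: "real^'n^'n"
  assumes "det A \<noteq> 0"
  shows "volume (norm_ellipsoid A) = volume (cball 0 1 :: (real^'n) set) / \<bar>det A\<bar>"
proof -
  obtain A' where A': "A ** A' = mat 1" using assms det_nz_inverse by blast
  then have "\<bar>det A\<bar> * \<bar>det A'\<bar> = 1" by (metis abs_mult abs_one det_I det_mul)
  then show ?thesis
    using assms by (simp add: norm_ellipsoid_eq_image[OF A'] volume_matrix_image field_simps)
qed

lemma volume_unit_ball_pos: "volume (cball 0 1 :: (real^'n) set) > 0"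
  using content_cball_pos[of 1 0] by (simp add: measure_completion)

lemma volume_norm_ellipsoid_le_iff:
  fixes A B :: "real^'n^'n"
  assumes "det A \<noteq> 0" "det B \<noteq> 0"
  shows "volume (norm_ellipsoid A) \<le> volume (norm_ellipsoid B) \<longleftrightarrow> \<bar>det B\<bar> \<le> \<bar>det A\<bar>"
  using assms volume_unit_ball_pos[where ?'n = 'n]
  by (simp add: volume_norm_ellipsoid field_simps)

lemma radial_norm_ellipsoid:
  fixes A :: "real^'n^'n"
  assumes "det A \<noteq> 0" "x \<noteq> 0"
  shows "radial (norm_ellipsoid A) x = 1 / norm (A *v x)"
proof -
  have pos: "norm (A *v x) > 0" using assms by (rule det_nz_norm_pos)
  then have "{l. l \<ge> 0 \<and> l *\<^sub>R x \<in> norm_ellipsoid A} = {0..1 / norm (A *v x)}"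
    by (auto simp: norm_ellipsoid_def field_simps matrix_vector_mult_scaleR)
  then show ?thesis using pos by (simp add: radial_def)
qed

section \<open>Polarity between inscribed and enclosing ellipsoids\<close>

lemma polar_matrix_image:
  fixes A :: "real^'n^'n"
  shows "polar_body ((*v) A ` cball 0 1) = norm_ellipsoid (transpose A)"
proof (intro equalityI subsetI)
  fix x assume x: "x \<in> polar_body ((*v) A ` cball 0 1)"
  let ?z = "transpose A *v x"
  show "x \<in> norm_ellipsoid (transpose A)"
  proof (cases "?z = 0")
    case False
    \<comment> \<open>With z = A^T x, the point of the unit ball at which y \<bullet> z is largest
      is z / |z|, and the value there is |z|. Testing the polar condition at its image is therefore
      enough; Cauchy-Schwarz gives the converse inclusion.\<close>
    then have "x \<bullet> (A *v (?z /\<^sub>R norm ?z)) \<le> 1"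
      using x unfolding polar_body_def by auto
    then have "?z \<bullet> (?z /\<^sub>R norm ?z) \<le> 1"
      using inner_matrix_vector_transpose[of A "?z /\<^sub>R norm ?z" x]
      by (simp only: inner_commute)
    then have "norm ?z \<le> 1"
      by (simp only: inner_scaleR_right dot_square_norm power2_eq_square) (use False in \<open>simp add: field_simps\<close>)
    then show ?thesis by (simp only: norm_ellipsoid_def mem_Collect_eq)
  next
    case True
    then have "norm ?z \<le> 1" by (metis norm_zero zero_le_one)
    then show ?thesis by (simp only: norm_ellipsoid_def mem_Collect_eq)
  qed
next
  fix x assume x: "x \<in> norm_ellipsoid (transpose A)"
  have "x \<bullet> (A *v y) \<le> 1" if "norm y \<le> 1" for y
  proof -
    have "x \<bullet> (A *v y) = y \<bullet> (transpose A *v x)"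
      using inner_matrix_vector_transpose[of A y x] by (simp only: inner_commute)
    also have "\<dots> \<le> norm y * norm (transpose A *v x)" by (rule norm_cauchy_schwarz)
    also have "\<dots> \<le> 1 * 1"
      using that x unfolding norm_ellipsoid_def mem_Collect_eq by (intro mult_mono) simp_all
    finally show ?thesis by simp
  qed
  then show "x \<in> polar_body ((*v) A ` cball 0 1)" by (auto simp: polar_body_def)
qed

lemma polar_norm_ellipsoid:
  fixes A :: "real^'n^'n"
  assumes "det A \<noteq> 0"
  shows "polar_body (norm_ellipsoid A) = (*v) (transpose A) ` cball 0 1"
proof -
  obtain A' where A': "A ** A' = mat 1" "A' ** A = mat 1" using assms det_nz_inverse by blast
  then have "transpose A' ** transpose A = mat 1" by (metis matrix_transpose_mul transpose_mat)
  then show ?thesis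
    by (simp only: norm_ellipsoid_eq_image[OF A'(1)] polar_matrix_image norm_ellipsoid_eq_image)
qed

lemma subset_polar_body_iff:
  fixes S T :: "(real^'n) set"
  shows "S \<subseteq> polar_body T \<longleftrightarrow> T \<subseteq> polar_body S"
  unfolding polar_body_def by (auto simp: inner_commute subset_eq; metis inner_commute)

lemma convex_polar_body: "convex (polar_body (S :: (real^'n) set))"
  unfolding polar_body_def convex_def
proof (intro ballI allI impI CollectI; clarify)
  fix x y z :: "real^'n" and u v :: real
  assume "\<forall>y\<in>S. x \<bullet> y \<le> 1" "\<forall>z\<in>S. y \<bullet> z \<le> 1" "z \<in> S" "0 \<le> u" "0 \<le> v" "u + v = 1"
  then have "u * (x \<bullet> z) + v * (y \<bullet> z) \<le> u * 1 + v * 1"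
    by (intro add_mono mult_left_mono) auto
  then show "(u *\<^sub>R x + v *\<^sub>R y) \<bullet> z \<le> 1" using \<open>u + v = 1\<close> by (simp add: inner_add_left)
qed

text \<open>Polarity reverses the inclusion and turns the image of the ball into an ellipsoid around
  conv K. The hull can then be dropped because that ellipsoid is convex.\<close>

lemma matrix_image_subset_polar_hull_iff:
  fixes A :: "real^'n^'n"
  shows "(*v) A ` cball 0 1 \<subseteq> polar_body (convex hull K) \<longleftrightarrow> K \<subseteq> norm_ellipsoid (transpose A)"
proof -
  have "(*v) A ` cball 0 1 \<subseteq> polar_body (convex hull K) \<longleftrightarrow> convex hull K \<subseteq> norm_ellipsoid (transpose A)"
    by (subst subset_polar_body_iff) (simp only: polar_matrix_image)
  also have "\<dots> \<longleftrightarrow> K \<subseteq> norm_ellipsoid (transpose A)"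
    using convex_polar_body[of "(*v) A ` cball 0 1"] unfolding polar_matrix_image
    by (metis hull_minimal hull_subset order_trans)
  finally show ?thesis .
qed

definition enclosing_matrices :: "(real^'n) set \<Rightarrow> (real^'n^'n) set" where
  "enclosing_matrices K = {A. K \<subseteq> norm_ellipsoid A}"

lemma mean_closed_enclosing:
  fixes K :: "(real^'n) set"
  shows "mean_closed (enclosing_matrices K)"
  unfolding mean_closed_def enclosing_matrices_def norm_ellipsoid_def
proof (intro ballI allI impI CollectI; clarify)
  fix A B C :: "real^'n^'n" and x
  assume "K \<subseteq> {x. norm (A *v x) \<le> 1}" "K \<subseteq> {x. norm (B *v x) \<le> 1}" "x \<in> K"
  then have "norm (A *v x) \<le> 1" "norm (B *v x) \<le> 1" by auto
  moreover assume "\<forall>x. norm (C *v x) \<le> (norm (A *v x) + norm (B *v x)) / 2"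
  then have "norm (C *v x) \<le> (norm (A *v x) + norm (B *v x)) / 2" ..
  ultimately show "norm (C *v x) \<le> 1" by simp
qed

text \<open>Writing inscribed ellipsoids as images under B^T makes their volume proportional to |det
  B| and the inclusion equivalent to B being enclosing. \<open>max_det_unique\<close> then supplies
  the uniqueness that \<open>THE\<close> requires, and a second polar returns to
  \<open>norm_ellipsoid A\<close>.\<close>

lemma L_infinity_eq_norm_ellipsoid:
  fixes A :: "real^'n^'n"
  assumes A: "max_det (enclosing_matrices K) A"
  shows "L_infinity_ellipsoid K = norm_ellipsoid A"
proof -
  let ?E = "(*v) (transpose A) ` cball 0 1"
  have iff: "(*v) (transpose B) ` cball 0 1 \<subseteq> polar_body (convex hull K) \<longleftrightarrow> B \<in> enclosing_matrices K"
    for B :: "real^'n^'n"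
    unfolding matrix_image_subset_polar_hull_iff enclosing_matrices_def by simp
  have vol: "volume ((*v) (transpose B) ` cball 0 1) = \<bar>det B\<bar> * volume (cball 0 1 :: (real^'n) set)"
    for B :: "real^'n^'n"
    by (simp only: volume_matrix_image det_transpose)
  have rep: "\<exists>B. det B \<noteq> 0 \<and> E = (*v) (transpose B) ` cball 0 1" if "E \<in> sym_ellipsoids"
    for E :: "(real^'n) set"
    using sym_ellipsoid_matrix_image[OF that] by (metis det_transpose transpose_transpose)
  have "max_inscribed_ellipsoid (polar_body (convex hull K)) = ?E"
    unfolding max_inscribed_ellipsoid_def
  proof (rule the_equality, intro conjI ballI impI)
    show "?E \<in> sym_ellipsoids"
      using A by (intro matrix_image_sym_ellipsoid) (auto simp: max_det_def)
    show "?E \<subseteq> polar_body (convex hull K)"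
      using A unfolding iff by (simp add: max_det_def)
    fix E assume "E \<in> sym_ellipsoids" "E \<subseteq> polar_body (convex hull K)"
    then obtain B where "E = (*v) (transpose B) ` cball 0 1" "B \<in> enclosing_matrices K"
      using rep iff by metis
    then show "volume E \<le> volume ?E"
      using A volume_unit_ball_pos[where ?'n = 'n] by (simp only: vol max_det_def mult_right_mono less_imp_le)
  next
    fix E assume E: "E \<in> sym_ellipsoids \<and> E \<subseteq> polar_body (convex hull K) \<and>
      (\<forall>E'\<in>sym_ellipsoids. E' \<subseteq> polar_body (convex hull K) \<longrightarrow> volume E' \<le> volume E)"
    then obtain B where B: "E = (*v) (transpose B) ` cball 0 1" "B \<in> enclosing_matrices K" "det B \<noteq> 0"
      using rep iff by metis
    have "volume ?E \<le> volume E"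
      using E A iff matrix_image_sym_ellipsoid[of "transpose A"] unfolding max_det_def det_transpose
      by blast
    then have "\<bar>det A\<bar> \<le> \<bar>det B\<bar>"
      using volume_unit_ball_pos[where ?'n = 'n] unfolding B(1) vol by simp
    then have "norm (B *v x) = norm (A *v x)" for x
      using max_det_unique[OF mean_closed_enclosing A B(2)] by blast
    then have "norm_ellipsoid B = norm_ellipsoid A" by (simp add: norm_ellipsoid_def)
    \<comment> \<open>B and A may differ by an orthogonal factor, so the images are identified
      through the polar of their common ellipsoid.\<close>
    then show "E = ?E"
      using polar_norm_ellipsoid[of A] polar_norm_ellipsoid[of B] B(1,3) A
      unfolding max_det_def by metis
  qed
  then show ?thesis
    unfolding L_infinity_ellipsoid_def by (simp only: polar_matrix_image transpose_transpose)
qed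
section \<open>The dual cone measure\<close>

text \<open>Half of the polar coordinate formula \<open>V(K) = \<integral>\<^bsub>B\<^esub> g\<^sup>n dx\<close> for the ball \<open>B\<close> and a degree-0 homogeneous
  \<open>g\<close>; the cones \<open>r \<theta>\<^sup>j \<le> g < r \<theta>\<^bsup>j+1\<^esup>\<close> are compared with their dilates by \<open>r \<theta>\<^sup>j\<close>, and then \<open>\<theta> \<rightarrow> 1\<close>.\<close>

lemma nn_integral_homogeneous_le:
  fixes g :: "'a::euclidean_space \<Rightarrow> real"
  assumes g[measurable]: "g \<in> borel_measurable borel"
    and r: "r > 0" "\<And>x. x \<noteq> 0 \<Longrightarrow> r \<le> g x"
    and hom: "\<And>c x. c > 0 \<Longrightarrow> g (c *\<^sub>R x) = g x"
    and K[measurable]: "K \<in> sets borel" "emeasure lborel K < \<infinity>"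
    and sub: "\<And>x. x \<noteq> 0 \<Longrightarrow> norm x < g x \<Longrightarrow> x \<in> K"
  shows "(\<integral>\<^sup>+x\<in>ball 0 1 - {0}. ennreal (g x ^ DIM('a)) \<partial>lborel) \<le> emeasure lborel K"
    (is "?I \<le> ?V")
proof -
  let ?n = "DIM('a)"
  have step: "?I \<le> ennreal (\<theta> ^ ?n) * ?V" if \<theta>: "\<theta> > 1" for \<theta>
  proof -
    define B where "B j = {x. x \<noteq> 0 \<and> r * \<theta> ^ j \<le> g x \<and> g x < r * \<theta> ^ Suc j}" for j
    define C where "C j = B j \<inter> ball 0 1" for j
    have mB[measurable]: "B j \<in> sets borel" for j unfolding B_def by measurable
    have mC[measurable]: "C j \<in> sets borel" for j unfolding C_def by measurable
    have disj: "disjoint_family B"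
      unfolding disjoint_family_on_def
    proof (intro ballI impI)
      fix i j :: nat assume "i \<noteq> j"
      then consider "Suc i \<le> j" | "Suc j \<le> i" by linarith
      then show "B i \<inter> B j = {}"
      proof cases
        case 1
        then have "r * \<theta> ^ Suc i \<le> r * \<theta> ^ j"
          using r \<theta> by (intro mult_left_mono power_increasing) auto
        then show ?thesis unfolding B_def by fastforce
      next
        case 2
        then have "r * \<theta> ^ Suc j \<le> r * \<theta> ^ i"
          using r \<theta> by (intro mult_left_mono power_increasing) auto
        then show ?thesis unfolding B_def by fastforce
      qed
    qed
    have "\<exists>j. x \<in> B j" if "x \<noteq> 0" for x
    proof -
      obtain N where N: "g x / r < \<theta> ^ N" using real_arch_pow[OF \<theta>] by blast
      \<comment> \<open>The least exponent is not 0 because g x / r is at least 1; its predecessor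
        indexes the cone that contains x.\<close>
      define m where "m = (LEAST N. g x / r < \<theta> ^ N)"
      have m: "g x / r < \<theta> ^ m" unfolding m_def using N by (rule LeastI)
      have "1 \<le> g x / r" using r that by simp
      then have "m \<noteq> 0" using m by (intro notI) simp
      then obtain j where j: "m = Suc j" using not0_implies_Suc by blast
      then have "\<not> g x / r < \<theta> ^ j" using not_less_Least[of j "\<lambda>N. g x / r < \<theta> ^ N"] by (simp add: m_def)
      then have "x \<in> B j" using m j that r by (auto simp: B_def field_simps)
      then show ?thesis ..
    qed
    moreover have "0 \<notin> B j" for j by (simp add: B_def)
    ultimately have UC: "ball 0 1 - {0} = (\<Union>j. C j)" unfolding C_def by (auto; metis)
    have disjC: "disjoint_family C"
      using disj by (auto simp: disjoint_family_on_def C_def)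
    have disjK: "disjoint_family (\<lambda>j. K \<inter> B j)"
      using disj by (auto simp: disjoint_family_on_def)
    have piece: "(\<integral>\<^sup>+x\<in>C j. ennreal (g x ^ ?n) \<partial>lborel) \<le> ennreal (\<theta> ^ ?n) * emeasure lborel (K \<inter> B j)" for j
    proof -
      \<comment> \<open>On this piece s <= g < \<theta> s. Replacing g by \<theta> s loses at most
        the factor \<theta>^n, and s^n is exactly the volume factor of the dilation by s.\<close>
      define s where "s = r * \<theta> ^ j"
      have s: "s > 0" using r \<theta> by (simp add: s_def)
      have "(\<integral>\<^sup>+x\<in>C j. ennreal (g x ^ ?n) \<partial>lborel) \<le> (\<integral>\<^sup>+x. ennreal ((\<theta> * s) ^ ?n) * indicator (C j) x \<partial>lborel)"
      proof (intro nn_integral_mono)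
        fix x
        have "g x ^ ?n \<le> (\<theta> * s) ^ ?n" if "x \<in> C j"
        proof (rule power_mono)
          show "g x \<le> \<theta> * s" using that by (simp add: C_def B_def s_def mult_ac)
          show "0 \<le> g x" using that r(2)[of x] r(1) by (simp add: C_def B_def)
        qed
        then show "ennreal (g x ^ ?n) * indicator (C j) x \<le> ennreal ((\<theta> * s) ^ ?n) * indicator (C j) x"
          by (auto split: split_indicator intro!: ennreal_leI)
      qed
      also have "\<dots> = ennreal ((\<theta> * s) ^ ?n) * emeasure lborel (C j)"
        by (simp add: nn_integral_cmult_indicator)
      also have "\<dots> = ennreal (\<theta> ^ ?n) * (ennreal (\<bar>s\<bar> ^ ?n) * emeasure lebesgue (C j))"
        using s \<theta> by (simp add: power_mult_distrib ennreal_mult mult.assoc)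
      also have "ennreal (\<bar>s\<bar> ^ ?n) * emeasure lebesgue (C j) = emeasure lebesgue ((\<lambda>x. s *\<^sub>R x + 0) ` C j)"
        by (subst emeasure_lebesgue_affine) (simp add: ennreal_power)
      also have "\<dots> \<le> emeasure lebesgue (K \<inter> B j)"
      proof (rule emeasure_mono)
        \<comment> \<open>A point x of the unit ball with s <= g x satisfies |s x| < s <= g x = g (s
          x), hence s x lies in K. Homogeneity also keeps it in the same cone, so the dilates for
          different j stay disjoint.\<close>
        show "(\<lambda>x. s *\<^sub>R x + 0) ` C j \<subseteq> K \<inter> B j"
        proof (rule image_subsetI)
          fix x assume x: "x \<in> C j"
          then have *: "s \<le> g x" "norm x < 1" "x \<noteq> 0" by (auto simp: C_def B_def s_def)
          then have "norm (s *\<^sub>R x) < g (s *\<^sub>R x)"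
            using s mult_strict_left_mono[of "norm x" 1 s] unfolding hom[OF s] norm_scaleR by linarith
          with * s have "s *\<^sub>R x \<in> K" by (intro sub) auto
          moreover have "s *\<^sub>R x \<in> B j" using x s by (simp add: C_def B_def hom)
          ultimately show "s *\<^sub>R x + 0 \<in> K \<inter> B j" by simp
        qed
      qed (use K mB in auto)
      also have "emeasure lebesgue (K \<inter> B j) = emeasure lborel (K \<inter> B j)"
        by simp
      finally show ?thesis by (simp add: mult_left_mono)
    qed
    have "?I = (\<Sum>j. \<integral>\<^sup>+x\<in>C j. ennreal (g x ^ ?n) \<partial>lborel)"
      unfolding UC using disjC by (intro nn_integral_disjoint_family) auto
    also have "\<dots> \<le> (\<Sum>j. ennreal (\<theta> ^ ?n) * emeasure lborel (K \<inter> B j))"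
      by (intro suminf_le piece) auto
    also have "\<dots> = ennreal (\<theta> ^ ?n) * emeasure lborel (\<Union>j. K \<inter> B j)"
      using disjK by (subst suminf_emeasure[symmetric]) auto
    also have "\<dots> \<le> ennreal (\<theta> ^ ?n) * ?V"
      by (intro mult_left_mono emeasure_mono) auto
    finally show ?thesis .
  qed
  obtain v where v: "?V = ennreal v" "v \<ge> 0" using K(2) by (cases ?V) auto
  have "((\<lambda>\<theta>. ennreal (\<theta> ^ ?n * v)) \<longlongrightarrow> ennreal (1 ^ ?n * v)) (at_right 1)"
    by (intro tendsto_intros tendsto_ennrealI)
  moreover have "\<forall>\<^sub>F \<theta> in at_right 1. ?I \<le> ennreal (\<theta> ^ ?n * v)"
    using step by (auto simp: v eventually_at_filter ennreal_mult)
  ultimately show ?thesis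
    using tendsto_lowerbound trivial_limit_at_right_real v by fastforce
qed

section \<open>Radial functions and volumes of star bodies\<close>

lemma star_body_bounds:
  fixes K :: "(real^'n) set"
  assumes "K \<in> star_bodies"
  obtains r R where "0 < r" "0 < R" "ball 0 r \<subseteq> K" "K \<subseteq> ball 0 R"
proof -
  from assms obtain r where "r > 0" "ball 0 r \<subseteq> K"
    by (auto simp: star_bodies_def mem_interior)
  moreover obtain R where "R > 0" "K \<subseteq> ball 0 R"
    using assms bounded_subset_ballD[of K 0] compact_imp_bounded by (auto simp: star_bodies_def)
  ultimately show thesis using that by blast
qed

text \<open>The supremum is over a nonempty, closed and bounded set, so it is attained;
  star-shapedness fills the segment below it.\<close>

lemma star_body_scaleR_mem_iff:
  fixes K :: "(real^'n) set"
  assumes K: "K \<in> star_bodies" and u: "norm u = 1" and l: "l \<ge> 0"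
  shows "l *\<^sub>R u \<in> K \<longleftrightarrow> l \<le> radial K u"
proof -
  obtain r R where rR: "0 < r" "0 < R" "ball 0 r \<subseteq> K" "K \<subseteq> ball 0 R"
    using star_body_bounds[OF K] .
  let ?L = "{l. l \<ge> 0 \<and> l *\<^sub>R u \<in> K}"
  have "l \<le> R" if "l \<in> ?L" for l
    using that rR(4) u by fastforce
  then have bdd: "bdd_above ?L" by (rule bdd_aboveI)
  have "0 \<in> ?L" using rR by auto
  moreover have "?L = {0..} \<inter> (\<lambda>l. l *\<^sub>R u) -` K" by auto
  moreover have "closed ({0..} \<inter> (\<lambda>l. l *\<^sub>R u) -` K)"
    using K by (intro closed_Int closed_vimage continuous_intros)
      (auto simp: star_bodies_def compact_imp_closed)
  ultimately have sup: "radial K u \<in> ?L"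
    unfolding radial_def using bdd by (intro closed_contains_Sup) auto
  show ?thesis
  proof
    assume "l *\<^sub>R u \<in> K"
    then show "l \<le> radial K u" unfolding radial_def using bdd l by (intro cSup_upper) auto
  next
    assume le: "l \<le> radial K u"
    show "l *\<^sub>R u \<in> K"
    proof (cases "radial K u = 0")
      case True then show ?thesis using le l sup by simp
    next
      case False
      then have "radial K u > 0" using le l by simp
      then have "(l / radial K u) *\<^sub>R (radial K u *\<^sub>R u) \<in> K"
        using K sup le l unfolding star_bodies_def by (auto simp del: scaleR_scaleR)
      then show ?thesis using False by simp
    qed
  qed
qed

lemma star_body_radial_bounds:
  fixes K :: "(real^'n) set"
  assumes K: "K \<in> star_bodies"
  obtains r R where "0 < r" "\<And>u. norm u = 1 \<Longrightarrow> r \<le> radial K u" "\<And>u. norm u = 1 \<Longrightarrow> radial K u \<le> R"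
proof -
  obtain r R where rR: "0 < r" "0 < R" "ball 0 r \<subseteq> K" "K \<subseteq> ball 0 R"
    using star_body_bounds[OF K] .
  have low: "r / 2 \<le> radial K u" if "norm u = 1" for u
  proof -
    have "(r / 2) *\<^sub>R u \<in> ball 0 r" using rR(1) that by simp
    then have "(r / 2) *\<^sub>R u \<in> K" using rR(3) by blast
    then show ?thesis using star_body_scaleR_mem_iff[OF K that, of "r / 2"] rR(1) by simp
  qed
  moreover have "radial K u \<le> R" if u: "norm u = 1" for u
  proof -
    have nonneg: "0 \<le> radial K u" using low[OF u] rR(1) by simp
    then have "radial K u *\<^sub>R u \<in> K"
      using star_body_scaleR_mem_iff[OF K u, of "radial K u"] by simp
    then have "norm (radial K u *\<^sub>R u) < R" using rR(4) by auto
    then show ?thesis using nonneg u by simp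
  qed
  ultimately show thesis using that[of "r / 2" R] rR by auto
qed

lemma star_body_volume_pos:
  fixes K :: "(real^'n) set"
  assumes K: "K \<in> star_bodies"
  shows "volume K > 0" "emeasure lborel K = ennreal (volume K)"
proof -
  obtain r R where rR: "0 < r" "0 < R" "ball 0 r \<subseteq> K" "K \<subseteq> ball 0 R"
    using star_body_bounds[OF K] .
  have c: "compact K" using K by (simp add: star_bodies_def)
  then have K_meas: "K \<in> lmeasurable" by (rule lmeasurable_compact)
  have "0 < volume (ball 0 r :: (real^'n) set)" using rR content_ball_pos[of r 0] by simp
  also have "\<dots> \<le> volume K"
    using rR K_meas by (intro measure_mono_fmeasurable) auto
  finally show "volume K > 0" .
  show "emeasure lborel K = ennreal (volume K)"
    using emeasure_compact_finite[OF c] c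
    by (simp add: emeasure_eq_ennreal_measure compact_imp_closed borel_closed)
qed

lemma radial_measurable:
  fixes K :: "(real^'n) set"
  assumes "K \<in> star_bodies"
  shows "radial K \<in> borel_measurable (restrict_space borel (sphere 0 1))"
  using assms by (intro borel_measurable_continuous_on_restrict) (simp add: star_bodies_def)

section \<open>Mass and support of the dual cone measure\<close>

lemma sets_spherical_measure[simp, measurable_cong]:
  "sets (spherical_measure :: (real^'n) measure) = sets (restrict_space borel (sphere 0 1))"
  by (simp add: spherical_measure_def)

lemma space_spherical_measure[simp]: "space (spherical_measure :: (real^'n) measure) = sphere 0 1"
  using sets_eq_imp_space_eq[OF sets_spherical_measure] by (simp add: space_restrict_space)

lemma sets_dual_cone_measure[simp, measurable_cong]:
  "sets (dual_cone_measure (K :: (real^'n) set)) = sets (restrict_space borel (sphere 0 1))"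
  by (simp add: dual_cone_measure_def)

lemma space_dual_cone_measure[simp]: "space (dual_cone_measure (K :: (real^'n) set)) = sphere 0 1"
  by (simp add: dual_cone_measure_def)

lemma nn_integral_spherical_measure:
  fixes f :: "real^'n \<Rightarrow> ennreal"
  assumes [measurable]: "f \<in> borel_measurable (restrict_space borel (sphere 0 1))"
  shows "(\<integral>\<^sup>+u. f u \<partial>spherical_measure) =
    of_nat CARD('n) * (\<integral>\<^sup>+x\<in>ball 0 1 - {0}. f (x /\<^sub>R norm x) \<partial>lborel)"
  unfolding spherical_measure_def
  by (simp add: nn_integral_scale_measure nn_integral_distr[OF radial_projection_measurable]
      nn_integral_restrict_space)

lemma dual_cone_density_measurable:
  fixes K :: "(real^'n) set"
  assumes "K \<in> star_bodies"
  shows "(\<lambda>u. ennreal (radial K u ^ CARD('n) / (real CARD('n) * volume K)))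
    \<in> borel_measurable (restrict_space borel (sphere 0 1))"
  using radial_measurable[OF assms] by simp

text \<open>The factor n of the spherical measure cancels the n in the density. What remains is the
  integral over the unit ball of the n-th power of the degree-0 extension of the radial function,
  divided by V(K).\<close>

lemma emeasure_dual_cone_measure_sphere_le:
  fixes K :: "(real^'n) set"
  assumes K: "K \<in> star_bodies"
  shows "emeasure (dual_cone_measure K) (sphere 0 1) \<le> 1"
proof -
  let ?n = "CARD('n)"
  obtain r R where r: "0 < r" "\<And>u. norm u = 1 \<Longrightarrow> r \<le> radial K u"
    using star_body_radial_bounds[OF K] by metis
  note [measurable] = radial_measurable[OF K]
  \<comment> \<open>The indicator removes the value at the origin, where \<open>radial K 0\<close>
    is the supremum of an unbounded set; continuity elsewhere then makes g Borel on the whole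
    space.\<close>
  define g where "g x = indicator (- {0}) x *\<^sub>R radial K (x /\<^sub>R norm x)" for x
  have cont: "continuous_on (- {0 :: real^'n}) (\<lambda>x. radial K (x /\<^sub>R norm x))"
  proof -
    have "continuous_on (sphere 0 1) (radial K)" using K by (simp add: star_bodies_def)
    moreover have "continuous_on (- {0 :: real^'n}) (\<lambda>x. x /\<^sub>R norm x)"
      by (intro continuous_intros) auto
    moreover have "(\<lambda>x. x /\<^sub>R norm x) ` (- {0 :: real^'n}) \<subseteq> sphere 0 1"
    proof (rule image_subsetI)
      fix x :: "real^'n" assume "x \<in> - {0}"
      then have "norm x \<noteq> 0" by simp
      then show "x /\<^sub>R norm x \<in> sphere 0 1" by simp
    qed
    ultimately show ?thesis by (rule continuous_on_compose2)
  qed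
  have [measurable]: "ball 0 1 - {0 :: real^'n} \<in> sets borel" by (intro sets.Diff) auto
  have g[measurable]: "g \<in> borel_measurable borel"
    using borel_measurable_continuous_on_restrict[OF cont]
    unfolding g_def by (subst (asm) borel_measurable_restrict_space_iff) auto
  have *: "(\<integral>\<^sup>+x\<in>ball 0 1 - {0}. ennreal (g x ^ DIM(real^'n)) \<partial>lborel) \<le> emeasure lborel K"
  proof (rule nn_integral_homogeneous_le[OF g r(1)])
    show "g (c *\<^sub>R x) = g x" if "c > 0" for c x
    proof -
      have eq: "inverse (norm (c *\<^sub>R x)) * c = inverse (norm x)"
        using that by (cases "x = 0") (simp_all add: field_simps)
      then show ?thesis
        unfolding g_def scaleR_scaleR eq using that by (simp add: indicator_def)
    qed
    show "K \<in> sets borel" using K by (simp add: star_bodies_def compact_imp_closed borel_closed)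
    show "emeasure lborel K < \<infinity>" using K using emeasure_compact_finite[of K] by (simp add: star_bodies_def)
    fix x :: "real^'n" assume x: "x \<noteq> 0"
    show "r \<le> g x" using x r by (simp add: g_def)
    assume "norm x < g x"
    then show "x \<in> K"
      using star_body_scaleR_mem_iff[OF K, of "x /\<^sub>R norm x" "norm x"] x by (simp add: g_def)
  qed
  have vol: "volume K > 0" "emeasure lborel K = ennreal (volume K)"
    using star_body_volume_pos[OF K] by auto
  have "emeasure (dual_cone_measure K) (sphere 0 1) =
      (\<integral>\<^sup>+u. ennreal (radial K u ^ ?n / (real ?n * volume K)) * indicator (sphere 0 1) u \<partial>spherical_measure)"
    unfolding dual_cone_measure_def
    by (subst emeasure_density) (auto simp: sets_restrict_space)
  also have "\<dots> = (\<integral>\<^sup>+u. ennreal (radial K u ^ ?n / (real ?n * volume K)) \<partial>spherical_measure)"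
    by (intro nn_integral_cong) auto
  also have "\<dots> = of_nat ?n * (\<integral>\<^sup>+x\<in>ball 0 1 - {0}. ennreal (radial K (x /\<^sub>R norm x) ^ ?n / (real ?n * volume K)) \<partial>lborel)"
    by (intro nn_integral_spherical_measure) simp
  also have "(\<integral>\<^sup>+x\<in>ball 0 1 - {0}. ennreal (radial K (x /\<^sub>R norm x) ^ ?n / (real ?n * volume K)) \<partial>lborel) =
      (\<integral>\<^sup>+x. ennreal (1 / (real ?n * volume K)) * (ennreal (g x ^ DIM(real^'n)) * indicator (ball 0 1 - {0}) x) \<partial>lborel)"
    using vol(1) by (intro nn_integral_cong)
      (auto split: split_indicator simp: g_def ennreal_mult' [symmetric])
  also have "\<dots> = ennreal (1 / (real ?n * volume K)) * (\<integral>\<^sup>+x\<in>ball 0 1 - {0}. ennreal (g x ^ DIM(real^'n)) \<partial>lborel)"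
    by (intro nn_integral_cmult) measurable
  also have "of_nat ?n * \<dots> \<le> of_nat ?n * (ennreal (1 / (real ?n * volume K)) * ennreal (volume K))"
    using * unfolding vol(2) by (intro mult_left_mono) auto
  also have "\<dots> = 1"
    using vol(1) by (simp add: ennreal_of_nat_eq_real_of_nat flip: ennreal_mult')
  finally show ?thesis .
qed

text \<open>The density is bounded below by a positive constant, and the cone over a relatively open
  set is open in the ambient space. A strict inequality at one direction can therefore be detected
  by integrals.\<close>

lemma emeasure_dual_cone_measure_open_pos:
  fixes K U :: "(real^'n) set"
  assumes K: "K \<in> star_bodies" and U: "open U" "u \<in> U" "norm u = 1"
  shows "emeasure (dual_cone_measure K) (U \<inter> sphere 0 1) > 0"
proof -
  let ?n = "CARD('n)"
  obtain r R where r: "0 < r" "\<And>u. norm u = 1 \<Longrightarrow> r \<le> radial K u"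
    using star_body_radial_bounds[OF K] by metis
  define c where "c = r ^ ?n / (real ?n * volume K)"
  have c: "c > 0" using r star_body_volume_pos(1)[OF K] by (simp add: c_def)
  let ?A = "U \<inter> sphere 0 1"
  have A: "?A \<in> sets borel" using U by (intro sets.Int) auto
  then have A': "?A \<in> sets spherical_measure" by (auto simp: sets_restrict_space image_iff)
  let ?C = "{t *\<^sub>R u | t u. 0 < t \<and> t < 1 \<and> u \<in> ?A}"
  define W where "W = {x \<in> ball 0 1 - {0}. x /\<^sub>R norm x \<in> U}"
  have "open W"
  proof -
    have "continuous_on (ball 0 1 - {0 :: real^'n}) (\<lambda>x. x /\<^sub>R norm x)"
      by (intro continuous_intros) auto
    then have "open ((ball 0 1 - {0}) \<inter> (\<lambda>x. x /\<^sub>R norm x) -` U)"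
      using U(1) by (intro continuous_open_preimage) (auto intro: open_delete)
    then show ?thesis by (simp add: W_def vimage_def Int_def)
  qed
  moreover have "W \<subseteq> ?C"
  proof
    fix x assume "x \<in> W"
    then have "x = norm x *\<^sub>R (x /\<^sub>R norm x)" "0 < norm x" "norm x < 1" "x /\<^sub>R norm x \<in> ?A"
      by (auto simp: W_def)
    then show "x \<in> ?C" by blast
  qed
  moreover have "?C \<subseteq> W"
    by (auto simp: W_def)
  moreover have "(1/2) *\<^sub>R u \<in> W" using U by (auto simp: W_def)
  ultimately have "open W" "W \<noteq> {}" "?C = W" by auto
  then have "\<not> negligible ?C" using open_not_negligible by metis
  then have "emeasure lborel ?C \<noteq> 0"
    using \<open>open W\<close> \<open>?C = W\<close> by (auto simp: negligible_iff_null_sets null_sets_def)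
  then have pos: "emeasure spherical_measure ?A > 0"
    using emeasure_spherical_measure[OF A] by (simp add: zero_less_iff_neq_zero)
  have "ennreal c * emeasure spherical_measure ?A =
      (\<integral>\<^sup>+v. ennreal c * indicator ?A v \<partial>spherical_measure)"
    using A' by (simp add: nn_integral_cmult_indicator)
  also have "\<dots> \<le> (\<integral>\<^sup>+v. ennreal (radial K v ^ ?n / (real ?n * volume K)) * indicator ?A v \<partial>spherical_measure)"
  proof (intro nn_integral_mono mult_right_mono ennreal_leI)
    fix v :: "real^'n" assume "v \<in> space spherical_measure"
    then have "r \<le> radial K v" using r by simp
    then show "c \<le> radial K v ^ ?n / (real ?n * volume K)"
      unfolding c_def using r(1) star_body_volume_pos(1)[OF K]
      by (intro divide_right_mono power_mono) auto
  qed simp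
  also have "\<dots> = emeasure (dual_cone_measure K) ?A"
    unfolding dual_cone_measure_def
    using A' dual_cone_density_measurable[OF K] by (subst emeasure_density) auto
  finally show ?thesis
    using c pos by (metis ennreal_zero_less_mult_iff ennreal_less_zero_iff less_le_trans)
qed

section \<open>Orlicz means over ellipsoids\<close>

lemma norm_matrix_vector_mult_le:
  fixes A :: "real^'n^'m"
  shows "norm (A *v x) \<le> norm A * norm x"
proof -
  have "norm (A *v x) = L2_set (\<lambda>i. \<bar>A $ i \<bullet> x\<bar>) UNIV"
    by (simp add: norm_vec_def matrix_vector_mul_component)
  also have "\<dots> \<le> L2_set (\<lambda>i. norm (A $ i) * norm x) UNIV"
    by (intro L2_set_mono Cauchy_Schwarz_ineq2) auto
  also have "\<dots> = norm A * norm x"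
    by (simp add: norm_vec_def[of A] L2_set_left_distrib)
  finally show ?thesis .
qed

lemma tendsto_matrix_vector_mult:
  fixes X :: "'a \<Rightarrow> real^'n^'m"
  assumes "(X \<longlongrightarrow> A) F"
  shows "((\<lambda>k. X k *v x) \<longlongrightarrow> A *v x) F"
  by (rule vec_tendstoI) (simp add: matrix_vector_mul_component tendsto_inner tendsto_vec_nth assms)

section \<open>Properties of the functions in \<open>Orlicz_class\<close>\<close>

lemma Orlicz_class_mono:
  assumes "\<phi> \<in> Orlicz_class" "0 \<le> x" "x \<le> y"
  shows "\<phi> x \<le> \<phi> y"
  using assms by (cases "x = y") (auto simp: Orlicz_class_def strict_mono_on_def less_imp_le)

text \<open>Convexity alone does not give continuity at the endpoint 0. Since \<phi> is increasing,
  its constant extension to the left is convex on the whole line, where convex functions are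
  continuous.\<close>

lemma Orlicz_class_continuous:
  assumes "\<phi> \<in> Orlicz_class"
  shows "continuous_on {0..} \<phi>"
proof -
  have conv: "convex_on {0..} \<phi>" using assms by (simp add: Orlicz_class_def)
  note mono = Orlicz_class_mono[OF assms]
  have "convex_on UNIV (\<lambda>t. \<phi> (max 0 t))"
  proof (rule convex_onI)
    fix t x y :: real assume t: "0 < t" "t < 1"
    have "\<phi> (max 0 ((1 - t) *\<^sub>R x + t *\<^sub>R y)) \<le> \<phi> ((1 - t) *\<^sub>R max 0 x + t *\<^sub>R max 0 y)"
    proof (rule mono)
      have "(1 - t) * x \<le> (1 - t) * max 0 x" "t * y \<le> t * max 0 y"
        "0 \<le> (1 - t) * max 0 x" "0 \<le> t * max 0 y"
        using t by (auto intro!: mult_left_mono)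
      then show "max 0 ((1 - t) *\<^sub>R x + t *\<^sub>R y) \<le> (1 - t) *\<^sub>R max 0 x + t *\<^sub>R max 0 y"
        unfolding real_scaleR_def by linarith
    qed simp
    also have "\<dots> \<le> (1 - t) * \<phi> (max 0 x) + t * \<phi> (max 0 y)"
      using t by (intro convex_onD[OF conv]) auto
    finally show "\<phi> (max 0 ((1 - t) *\<^sub>R x + t *\<^sub>R y)) \<le> (1 - t) * \<phi> (max 0 x) + t * \<phi> (max 0 y)" .
  qed simp
  then have "continuous_on UNIV (\<lambda>t. \<phi> (max 0 t))"
    by (intro convex_on_continuous) auto
  then have "continuous_on {0..} (\<lambda>t. \<phi> (max 0 t))" by (rule continuous_on_subset) simp
  then show ?thesis by (rule continuous_on_eq) simp
qed

lemma Orlicz_class_less: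
  assumes "\<phi> \<in> Orlicz_class" "0 \<le> x" "x < y"
  shows "\<phi> x < \<phi> y"
  using assms by (auto simp: Orlicz_class_def strict_mono_on_def)

lemma Orlicz_class_nonneg: "\<phi> \<in> Orlicz_class \<Longrightarrow> 0 \<le> x \<Longrightarrow> 0 \<le> \<phi> x"
  by (simp add: Orlicz_class_def)

lemma Orlicz_class_zero: "\<phi> \<in> Orlicz_class \<Longrightarrow> \<phi> 0 = 0"
  by (simp add: Orlicz_class_def)

lemma Orlicz_class_one_pos: "\<phi> \<in> Orlicz_class \<Longrightarrow> 0 < \<phi> 1"
  using Orlicz_class_less[of \<phi> 0 1] by (simp add: Orlicz_class_zero)

text \<open>For s > 1 convexity and \<open>\<phi> 0 = 0\<close> give \<phi>(s) >= s \<phi>(1); for s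
  <= 1 the left side is not positive. After division by \<phi>(1) the bound no longer depends on
  \<phi>, which is what makes estimates uniform in p.\<close>

lemma Orlicz_class_linear_lower_bound:
  assumes \<phi>: "\<phi> \<in> Orlicz_class" and "0 \<le> s"
  shows "\<phi> 1 * (s - 1) \<le> \<phi> s"
proof (cases "s \<le> 1")
  case True
  then have "\<phi> 1 * (s - 1) \<le> 0"
    using Orlicz_class_one_pos[OF \<phi>] by (intro mult_nonneg_nonpos) auto
  also have "0 \<le> \<phi> s" using assms by (rule Orlicz_class_nonneg)
  finally show ?thesis .
next
  case False
  have "convex_on {0..} \<phi>" using \<phi> by (simp add: Orlicz_class_def)
  from convex_onD[OF this, of "1 / s" 0 s] False
  have "\<phi> 1 \<le> \<phi> s / s" by (simp add: Orlicz_class_zero[OF \<phi>])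
  then have "\<phi> 1 * s \<le> \<phi> s" using False by (simp add: field_simps)
  then show ?thesis using Orlicz_class_one_pos[OF \<phi>] by (simp add: algebra_simps)
qed

lemma Orlicz_class_surj:
  assumes \<phi>: "\<phi> \<in> Orlicz_class" and "0 \<le> y"
  obtains x where "0 \<le> x" "\<phi> x = y"
proof -
  \<comment> \<open>Chosen so that the linear lower bound \<phi>(1) (b - 1) equals y.\<close>
  define b where "b = 1 + y / \<phi> 1"
  have pos: "0 < \<phi> 1" using \<phi> by (rule Orlicz_class_one_pos)
  have b: "0 \<le> b" using pos assms(2) by (simp add: b_def)
  then have "\<phi> 1 * (b - 1) \<le> \<phi> b" by (rule Orlicz_class_linear_lower_bound[OF \<phi>])
  then have "y \<le> \<phi> b" using pos by (simp add: b_def)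
  moreover have "continuous_on {0..b} \<phi>"
    using Orlicz_class_continuous[OF \<phi>] by (rule continuous_on_subset) auto
  ultimately obtain x where "0 \<le> x" "x \<le> b" "\<phi> x = y"
    using IVT'[of \<phi> 0 y b] assms(2) b Orlicz_class_zero[OF \<phi>] by auto
  then show thesis using that by blast
qed

lemma inv_into_Orlicz_le_one_iff:
  assumes \<phi>: "\<phi> \<in> Orlicz_class" and "0 \<le> y"
  shows "inv_into {0..} \<phi> y \<le> 1 \<longleftrightarrow> y \<le> \<phi> 1"
proof -
  obtain x where x: "0 \<le> x" "\<phi> x = y" using Orlicz_class_surj[OF assms] .
  have "inj_on \<phi> {0..}"
    using \<phi> by (auto simp: Orlicz_class_def intro: strict_mono_on_imp_inj_on)
  then have "inv_into {0..} \<phi> y = x" using x by (metis atLeast_iff inv_into_f_f)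
  then show ?thesis
    using x Orlicz_class_mono[OF \<phi>, of x 1] Orlicz_class_less[OF \<phi>, of 1 x] by force
qed

lemma Orlicz_class_powr:
  assumes \<phi>: "\<phi> \<in> Orlicz_class" and p: "p \<ge> 1"
  shows "(\<lambda>t. \<phi> t powr p) \<in> Orlicz_class"
  unfolding Orlicz_class_def
proof (intro CollectI conjI)
  have nonneg: "\<And>t. 0 \<le> t \<Longrightarrow> 0 \<le> \<phi> t" using Orlicz_class_nonneg[OF \<phi>] .
  show "\<forall>t\<ge>0. 0 \<le> \<phi> t powr p" by simp
  show "\<phi> 0 powr p = 0" using Orlicz_class_zero[OF \<phi>] by simp
  show "strict_mono_on {0..} (\<lambda>t. \<phi> t powr p)"
    using Orlicz_class_less[OF \<phi>] nonneg p by (auto simp: strict_mono_on_def intro!: powr_less_mono2)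
  show "convex_on {0..} (\<lambda>t. \<phi> t powr p)"
  proof (rule convex_onI)
    fix t x y :: real assume t: "0 < t" "t < 1" and xy: "x \<in> {0..}" "y \<in> {0..}"
    let ?z = "(1 - t) *\<^sub>R x + t *\<^sub>R y"
    have conv: "convex_on {0..} \<phi>" using \<phi> by (simp add: Orlicz_class_def)
    have "\<phi> ?z powr p \<le> ((1 - t) * \<phi> x + t * \<phi> y) powr p"
      using t xy p convex_onD[OF conv, of t x y] nonneg[of ?z] by (intro powr_mono2) auto
    also have "\<dots> \<le> (1 - t) * \<phi> x powr p + t * \<phi> y powr p"
    proof -
      \<comment> \<open>For positive arguments convexity of \<open>powr\<close> applies. If one
        argument is 0, the claim reduces to w powr p <= w for the weight w of the other one.\<close>
      consider "x = 0" | "y = 0" | "x > 0" "y > 0" using xy by force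
      then show ?thesis
      proof cases
        case 1
        have "t powr p \<le> t powr 1" using t p by (intro powr_mono') auto
        then show ?thesis
          using 1 t nonneg[of y] xy by (simp add: Orlicz_class_zero[OF \<phi>] powr_mult mult_right_mono)
      next
        case 2
        have "(1 - t) powr p \<le> (1 - t) powr 1" using t p by (intro powr_mono') auto
        then show ?thesis
          using 2 t nonneg[of x] xy by (simp add: Orlicz_class_zero[OF \<phi>] powr_mult mult_right_mono)
      next
        case 3
        then have "\<phi> x > 0" "\<phi> y > 0"
          using Orlicz_class_less[OF \<phi>, of 0] Orlicz_class_zero[OF \<phi>] by auto
        then show ?thesis
          using convex_onD[OF powr_convex[OF p], of t "\<phi> x" "\<phi> y"] t by simp
      qed
    qed
    finally show "\<phi> ?z powr p \<le> (1 - t) * \<phi> x powr p + t * \<phi> y powr p" .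
  qed simp
qed

lemma Orlicz_class_id: "(\<lambda>t. t) \<in> Orlicz_class"
  by (auto simp: Orlicz_class_def strict_mono_on_def convex_on_ident)

text \<open>The integral from \<open>Orlicz_functional\<close> at scale 1, with the reciprocal
  radial function of the ellipsoid written as |A u|. In this form it makes sense, and is continuous,
  also at singular matrices.\<close>

definition Orlicz_mean :: "(real \<Rightarrow> real) \<Rightarrow> (real^'n) set \<Rightarrow> real^'n^'n \<Rightarrow> real" where
  "Orlicz_mean \<phi> K A = (\<integral>u. \<phi> (radial K u * norm (A *v u)) \<partial>dual_cone_measure K)"

lemma finite_measure_dual_cone_measure:
  fixes K :: "(real^'n) set"
  assumes "K \<in> star_bodies"
  shows "finite_measure (dual_cone_measure K)"
proof (rule finite_measureI)
  have "emeasure (dual_cone_measure K) (sphere 0 1) < top"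
    using emeasure_dual_cone_measure_sphere_le[OF assms] ennreal_one_less_top by (rule le_less_trans)
  then show "emeasure (dual_cone_measure K) (space (dual_cone_measure K)) \<noteq> \<infinity>"
    by simp
qed

lemma measure_dual_cone_measure_le_one:
  fixes K :: "(real^'n) set"
  assumes "K \<in> star_bodies"
  shows "measure (dual_cone_measure K) (sphere 0 1) \<le> 1"
  using emeasure_dual_cone_measure_sphere_le[OF assms] unfolding measure_def
  by (intro enn2real_leI) simp_all

lemma integrable_dual_cone_measure:
  fixes f :: "real^'n \<Rightarrow> real"
  assumes K: "K \<in> star_bodies" and f: "continuous_on (sphere 0 1) f"
  shows "integrable (dual_cone_measure K) f"
proof -
  interpret finite_measure "dual_cone_measure K"
    using K by (rule finite_measure_dual_cone_measure)
  have "bounded (f ` sphere 0 1)"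
    by (intro compact_imp_bounded compact_continuous_image f) simp
  then obtain B where "\<And>y. y \<in> f ` sphere 0 1 \<Longrightarrow> norm y \<le> B"
    unfolding bounded_iff by blast
  then have "AE u in dual_cone_measure K. norm (f u) \<le> B"
    by (intro AE_I2) simp
  moreover have "f \<in> borel_measurable (dual_cone_measure K)"
    using borel_measurable_continuous_on_restrict[OF f]
    by (simp cong: measurable_cong_sets)
  ultimately show ?thesis by (intro integrable_const_bound)
qed

lemma continuous_on_Orlicz_integrand:
  fixes K :: "(real^'n) set" and A :: "real^'n^'n" and \<phi> :: "real \<Rightarrow> real"
  assumes K: "K \<in> star_bodies" and \<phi>: "continuous_on {0..} \<phi>"
  shows "continuous_on (sphere 0 1) (\<lambda>u. \<phi> (radial K u * norm (A *v u)))"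
proof (rule continuous_on_compose2[OF \<phi>])
  show "continuous_on (sphere 0 1) (\<lambda>u. radial K u * norm (A *v u))"
    using K by (intro continuous_on_mult continuous_on_norm matrix_vector_mult_linear_continuous_on)
      (simp add: star_bodies_def)
  obtain r R where "0 < r" "\<And>u. norm u = 1 \<Longrightarrow> r \<le> radial K u"
    using star_body_radial_bounds[OF K] by metis
  then show "(\<lambda>u. radial K u * norm (A *v u)) ` sphere 0 1 \<subseteq> {0..}"
    by (fastforce intro: mult_nonneg_nonneg)
qed

lemma integrable_Orlicz_integrand:
  fixes K :: "(real^'n) set" and A :: "real^'n^'n" and \<phi> :: "real \<Rightarrow> real"
  assumes "K \<in> star_bodies" "continuous_on {0..} \<phi>"
  shows "integrable (dual_cone_measure K) (\<lambda>u. \<phi> (radial K u * norm (A *v u)))"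
  using assms(1) continuous_on_Orlicz_integrand[OF assms] by (rule integrable_dual_cone_measure)

text \<open>Dominated convergence: a convergent sequence of matrices is bounded, so all arguments of
  \<phi> stay in one compact interval, on which \<phi> is bounded.\<close>

lemma Orlicz_mean_tendsto:
  fixes K :: "(real^'n) set" and \<phi> :: "real \<Rightarrow> real" and X :: "nat \<Rightarrow> real^'n^'n"
  assumes K: "K \<in> star_bodies" and \<phi>: "continuous_on {0..} \<phi>" and X: "X \<longlonglongrightarrow> A"
  shows "(\<lambda>k. Orlicz_mean \<phi> K (X k)) \<longlonglongrightarrow> Orlicz_mean \<phi> K A"
proof -
  interpret finite_measure "dual_cone_measure K"
    using K by (rule finite_measure_dual_cone_measure)
  obtain r R where rR: "0 < r" "\<And>u. norm u = 1 \<Longrightarrow> r \<le> radial K u" "\<And>u. norm u = 1 \<Longrightarrow> radial K u \<le> R"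
    using star_body_radial_bounds[OF K] by metis
  then have nonneg: "0 \<le> radial K u" if "norm u = 1" for u using that by fastforce
  obtain Y where Y: "\<And>k. norm (X k) \<le> Y"
    using X convergent_imp_Bseq[of X] by (auto simp: convergent_def Bseq_def)
  have "compact (\<phi> ` {0..R * Y})"
    using \<phi> by (intro compact_continuous_image) (auto intro: continuous_on_subset)
  then obtain B where B: "\<And>t. 0 \<le> t \<Longrightarrow> t \<le> R * Y \<Longrightarrow> norm (\<phi> t) \<le> B"
    using compact_imp_bounded by (fastforce simp: bounded_iff)
  have range: "0 \<le> radial K u * norm (X k *v u)" "radial K u * norm (X k *v u) \<le> R * Y"
    if "norm u = 1" for u k
  proof -
    have "norm (X k *v u) \<le> Y"
      using norm_matrix_vector_mult_le[of "X k" u] Y[of k] that by simp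
    then show "radial K u * norm (X k *v u) \<le> R * Y"
      using rR nonneg that by (intro mult_mono) (auto intro: order_trans)
    show "0 \<le> radial K u * norm (X k *v u)" using nonneg that by simp
  qed
  show ?thesis
    unfolding Orlicz_mean_def
  proof (rule integral_dominated_convergence[where w = "\<lambda>_. B"])
    show "AE u in dual_cone_measure K. (\<lambda>k. \<phi> (radial K u * norm (X k *v u))) \<longlonglongrightarrow> \<phi> (radial K u * norm (A *v u))"
    proof (rule AE_I2)
      fix u assume "u \<in> space (dual_cone_measure K)"
      then have u: "norm u = 1" by simp
      have lim: "(\<lambda>k. radial K u * norm (X k *v u)) \<longlonglongrightarrow> radial K u * norm (A *v u)"
        by (intro tendsto_intros tendsto_matrix_vector_mult X)
      show "(\<lambda>k. \<phi> (radial K u * norm (X k *v u))) \<longlonglongrightarrow> \<phi> (radial K u * norm (A *v u))"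
        using range[OF u] nonneg[OF u] by (intro continuous_on_tendsto_compose[OF \<phi> lim]) auto
    qed
    show "AE u in dual_cone_measure K. norm (\<phi> (radial K u * norm (X k *v u))) \<le> B" for k
      using B range by (intro AE_I2) auto
  qed (use integrable_Orlicz_integrand[OF K \<phi>] in \<open>auto intro: borel_measurable_integrable\<close>)
qed

text \<open>Markov's inequality, the source of the lower bounds on means.\<close>

lemma Orlicz_mean_ge:
  fixes K U :: "(real^'n) set"
  assumes K: "K \<in> star_bodies" and \<phi>: "\<phi> \<in> Orlicz_class" and U: "open U" and t: "0 \<le> t"
    and ge: "\<And>u. u \<in> U \<Longrightarrow> norm u = 1 \<Longrightarrow> t \<le> radial K u * norm (A *v u)"
  shows "\<phi> t * measure (dual_cone_measure K) (U \<inter> sphere 0 1) \<le> Orlicz_mean \<phi> K A"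
proof -
  interpret finite_measure "dual_cone_measure K"
    using K by (rule finite_measure_dual_cone_measure)
  obtain r R where r: "0 < r" "\<And>u. norm u = 1 \<Longrightarrow> r \<le> radial K u"
    using star_body_radial_bounds[OF K] by metis
  have U': "U \<inter> sphere 0 1 \<in> sets (dual_cone_measure K)"
    using U by (auto simp: sets_restrict_space)
  have "\<phi> t * measure (dual_cone_measure K) (U \<inter> sphere 0 1)
      = (\<integral>u. \<phi> t * indicator (U \<inter> sphere 0 1) u \<partial>dual_cone_measure K)"
    using U' by simp
  also have "\<dots> \<le> Orlicz_mean \<phi> K A"
    unfolding Orlicz_mean_def
  proof (rule integral_mono)
    show "integrable (dual_cone_measure K) (\<lambda>u. \<phi> t * indicator (U \<inter> sphere 0 1) u)"
      using U' by (intro integrable_mult_right integrable_real_indicator) (auto simp: less_top[symmetric])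
    show "integrable (dual_cone_measure K) (\<lambda>u. \<phi> (radial K u * norm (A *v u)))"
      using K Orlicz_class_continuous[OF \<phi>] by (rule integrable_Orlicz_integrand)
    fix u assume "u \<in> space (dual_cone_measure K)"
    then have u: "norm u = 1" by simp
    then have "0 \<le> radial K u * norm (A *v u)" using r by fastforce
    then show "\<phi> t * indicator (U \<inter> sphere 0 1) u \<le> \<phi> (radial K u * norm (A *v u))"
      using ge[of u] u t Orlicz_class_mono[OF \<phi>] Orlicz_class_nonneg[OF \<phi>]
      by (auto split: split_indicator)
  qed
  finally show ?thesis .
qed

text \<open>For the identity the mean is positively homogeneous in A, continuous, and positive off
  0, since A u is nonzero on a set of directions of positive measure. The constant is its minimum on
  the unit sphere of matrices.\<close>

lemma Orlicz_mean_id_coercive: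
  fixes K :: "(real^'n) set"
  assumes K: "K \<in> star_bodies"
  obtains c where "0 < c" "\<And>A. c * norm A \<le> Orlicz_mean (\<lambda>t. t) K A"
proof -
  let ?I = "Orlicz_mean (\<lambda>t. t) K" and ?S = "sphere 0 1 :: (real^'n^'n) set"
  interpret finite_measure "dual_cone_measure K"
    using K by (rule finite_measure_dual_cone_measure)
  obtain r R where r: "0 < r" "\<And>u. norm u = 1 \<Longrightarrow> r \<le> radial K u"
    using star_body_radial_bounds[OF K] by metis
  have pos: "?I A > 0" if A: "A \<noteq> 0" for A
  proof -
    obtain x where x: "A *v x \<noteq> 0"
      using A matrix_eq[of A 0] by auto
    then have "x \<noteq> 0" by auto
    define u where "u = x /\<^sub>R norm x"
    have u: "norm u = 1" "norm (A *v u) > 0"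
      using x \<open>x \<noteq> 0\<close> by (auto simp: u_def matrix_vector_mult_scaleR)
    define s where "s = norm (A *v u) / 2"
    define U where "U = {v. s < norm (A *v v)}"
    have "open U" unfolding U_def
      by (intro open_Collect_less continuous_intros)
    moreover have "u \<in> U" using u by (simp add: U_def s_def)
    ultimately have "measure (dual_cone_measure K) (U \<inter> sphere 0 1) > 0"
      using emeasure_dual_cone_measure_open_pos[OF K _ _ u(1)] by (simp add: emeasure_eq_measure)
    moreover have "r * s > 0" using r u by (simp add: s_def)
    moreover have "r * s * measure (dual_cone_measure K) (U \<inter> sphere 0 1) \<le> ?I A"
    proof (rule Orlicz_mean_ge[OF K Orlicz_class_id \<open>open U\<close>])
      show "r * s \<le> radial K v * norm (A *v v)" if "v \<in> U" "norm v = 1" for v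
        using that r u by (intro mult_mono) (auto simp: U_def s_def intro: order_trans less_imp_le)
    qed (use \<open>r * s > 0\<close> in auto)
    ultimately show ?thesis by (meson less_le_trans mult_pos_pos)
  qed
  have cont: "continuous_on ?S ?I"
    unfolding continuous_on_sequentially o_def
    using Orlicz_mean_tendsto[OF K, of "\<lambda>t. t"] by auto
  have "?S \<noteq> {}" by simp
  then obtain A0 where A0: "A0 \<in> ?S" "\<And>A. A \<in> ?S \<Longrightarrow> ?I A0 \<le> ?I A"
    using continuous_attains_inf[OF _ _ cont] by auto
  have "?I A0 * norm A \<le> ?I A" for A
  proof (cases "A = 0")
    case True
    then show ?thesis by (simp add: Orlicz_mean_def)
  next
    case False
    have "?I A0 \<le> ?I (A /\<^sub>R norm A)" using False by (intro A0(2)) simp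
    also have "\<dots> = ?I A / norm A"
      unfolding Orlicz_mean_def
      by (simp add: scaleR_matrix_vector_assoc[symmetric] divide_inverse mult_ac flip: integral_mult_right_zero)
    finally show ?thesis using False by (simp add: field_simps)
  qed
  moreover have "?I A0 > 0" using A0(1) by (intro pos) auto
  ultimately show thesis using that by blast
qed

section \<open>The two constraint sets of matrices\<close>

definition Orlicz_matrices :: "(real \<Rightarrow> real) \<Rightarrow> (real^'n) set \<Rightarrow> (real^'n^'n) set" where
  "Orlicz_matrices \<phi> K = {A. Orlicz_mean \<phi> K A \<le> \<phi> 1}"

text \<open>The bound is uniform in \<open>\<phi>\<close>, and hence applies to all powers \<open>\<phi>\<^sup>p\<close> at once.\<close>

lemma Orlicz_matrices_bounded:
  fixes K :: "(real^'n) set"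
  assumes K: "K \<in> star_bodies"
  obtains R where "\<And>\<phi> A. \<phi> \<in> Orlicz_class \<Longrightarrow> A \<in> Orlicz_matrices \<phi> K \<Longrightarrow> norm A \<le> R"
proof -
  obtain c where c: "0 < c" "\<And>A. c * norm A \<le> Orlicz_mean (\<lambda>t. t) K A"
    using Orlicz_mean_id_coercive[OF K] by blast
  interpret finite_measure "dual_cone_measure K"
    using K by (rule finite_measure_dual_cone_measure)
  obtain r R where r: "0 < r" "\<And>u. norm u = 1 \<Longrightarrow> r \<le> radial K u"
    using star_body_radial_bounds[OF K] by metis
  have "norm A \<le> 2 / c" if \<phi>: "\<phi> \<in> Orlicz_class" and A: "A \<in> Orlicz_matrices \<phi> K" for \<phi> A
  proof -
    let ?M = "dual_cone_measure K"
    have pos: "\<phi> 1 > 0" using \<phi> by (rule Orlicz_class_one_pos)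
    have int: "integrable ?M (\<lambda>u. radial K u * norm (A *v u))"
      using integrable_Orlicz_integrand[OF K continuous_on_id] .
    \<comment> \<open>Integrating the linear lower bound and cancelling \<phi>(1) bounds the
      identity mean by 1 plus the mass of the measure, hence by 2; coercivity turns this into |A| <=
      2/c.\<close>
    have "\<phi> 1 * (Orlicz_mean (\<lambda>t. t) K A - measure ?M (sphere 0 1))
        = (\<integral>u. \<phi> 1 * (radial K u * norm (A *v u) - 1) \<partial>?M)"
      unfolding Orlicz_mean_def using int by (simp add: Bochner_Integration.integral_diff)
    also have "\<dots> \<le> Orlicz_mean \<phi> K A"
      unfolding Orlicz_mean_def
    proof (rule integral_mono)
      show "integrable ?M (\<lambda>u. \<phi> 1 * (radial K u * norm (A *v u) - 1))" using int by simp
      show "integrable ?M (\<lambda>u. \<phi> (radial K u * norm (A *v u)))"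
        using K Orlicz_class_continuous[OF \<phi>] by (rule integrable_Orlicz_integrand)
      fix u assume "u \<in> space ?M"
      then have "0 \<le> radial K u * norm (A *v u)" using r by fastforce
      then show "\<phi> 1 * (radial K u * norm (A *v u) - 1) \<le> \<phi> (radial K u * norm (A *v u))"
        by (rule Orlicz_class_linear_lower_bound[OF \<phi>])
    qed
    also have "\<dots> \<le> \<phi> 1 * 1" using A by (simp add: Orlicz_matrices_def)
    finally have "Orlicz_mean (\<lambda>t. t) K A - measure ?M (sphere 0 1) \<le> 1"
      using pos by (simp only: mult_le_cancel_left_pos)
    then have "c * norm A \<le> 2"
      using measure_dual_cone_measure_le_one[OF K] c(2)[of A] by linarith
    then show ?thesis using c(1) by (simp add: field_simps)
  qed
  with that show thesis by blast
qed

lemma compact_Orlicz_matrices: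
  fixes K :: "(real^'n) set"
  assumes K: "K \<in> star_bodies" and \<phi>: "\<phi> \<in> Orlicz_class"
  shows "compact (Orlicz_matrices \<phi> K)"
  unfolding compact_eq_bounded_closed
proof
  show "bounded (Orlicz_matrices \<phi> K)"
    using Orlicz_matrices_bounded[OF K] \<phi> by (metis bounded_iff)
  show "closed (Orlicz_matrices \<phi> K)"
    unfolding closed_sequential_limits
  proof (intro allI impI, elim conjE)
    fix X A assume X: "\<forall>n. X n \<in> Orlicz_matrices \<phi> K" "X \<longlonglongrightarrow> A"
    have "(\<lambda>k. Orlicz_mean \<phi> K (X k)) \<longlonglongrightarrow> Orlicz_mean \<phi> K A"
      using K Orlicz_class_continuous[OF \<phi>] X(2) by (rule Orlicz_mean_tendsto)
    then show "A \<in> Orlicz_matrices \<phi> K"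
      using X(1) unfolding Orlicz_matrices_def by (auto intro: LIMSEQ_le_const2)
  qed
qed

text \<open>Under the integral, monotonicity of \<phi> replaces |C u| by the mean of |A u| and |B
  u|, and midpoint convexity takes this mean out of \<phi>.\<close>

lemma mean_closed_Orlicz_matrices:
  fixes K :: "(real^'n) set"
  assumes K: "K \<in> star_bodies" and \<phi>: "\<phi> \<in> Orlicz_class"
  shows "mean_closed (Orlicz_matrices \<phi> K)"
  unfolding mean_closed_def
proof (intro ballI allI impI)
  fix A B C :: "real^'n^'n"
  assume A: "A \<in> Orlicz_matrices \<phi> K" and B: "B \<in> Orlicz_matrices \<phi> K"
    and C: "\<forall>x. norm (C *v x) \<le> (norm (A *v x) + norm (B *v x)) / 2"
  let ?M = "dual_cone_measure K" and ?f = "\<lambda>(A :: real^'n^'n) u. \<phi> (radial K u * norm (A *v u))"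
  obtain r R where r: "0 < r" "\<And>u. norm u = 1 \<Longrightarrow> r \<le> radial K u"
    using star_body_radial_bounds[OF K] by metis
  have conv: "convex_on {0..} \<phi>" using \<phi> by (simp add: Orlicz_class_def)
  have int: "integrable ?M (?f A)" for A :: "real^'n^'n"
    using K Orlicz_class_continuous[OF \<phi>] by (rule integrable_Orlicz_integrand)
  have "Orlicz_mean \<phi> K C \<le> (\<integral>u. (?f A u + ?f B u) / 2 \<partial>?M)"
    unfolding Orlicz_mean_def
  proof (rule integral_mono[OF int])
    show "integrable ?M (\<lambda>u. (?f A u + ?f B u) / 2)" using int by simp
    fix u assume "u \<in> space ?M"
    then have u: "0 \<le> radial K u" using r by fastforce
    let ?a = "radial K u * norm (A *v u)" and ?b = "radial K u * norm (B *v u)"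
    have "radial K u * norm (C *v u) \<le> radial K u * ((norm (A *v u) + norm (B *v u)) / 2)"
      using u C by (intro mult_left_mono) auto
    then have "?f C u \<le> \<phi> ((1 - 1/2) *\<^sub>R ?a + (1/2) *\<^sub>R ?b)"
      using u by (intro Orlicz_class_mono[OF \<phi>]) (simp_all add: algebra_simps)
    also have "\<dots> \<le> (1 - 1/2) * \<phi> ?a + (1/2) * \<phi> ?b"
      using u by (intro convex_onD[OF conv]) auto
    finally show "?f C u \<le> (?f A u + ?f B u) / 2" by simp
  qed
  also have "\<dots> = (Orlicz_mean \<phi> K A + Orlicz_mean \<phi> K B) / 2"
    unfolding Orlicz_mean_def using int by simp
  also have "\<dots> \<le> \<phi> 1" using A B by (simp add: Orlicz_matrices_def)
  finally show "C \<in> Orlicz_matrices \<phi> K" by (simp add: Orlicz_matrices_def)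
qed

text \<open>Puts containment into terms of the argument of \<phi> in \<open>Orlicz_mean\<close>, so
  that the two constraints can be compared pointwise.\<close>

lemma enclosing_matrices_iff:
  fixes K :: "(real^'n) set"
  assumes K: "K \<in> star_bodies"
  shows "A \<in> enclosing_matrices K \<longleftrightarrow> (\<forall>u. norm u = 1 \<longrightarrow> radial K u * norm (A *v u) \<le> 1)"
proof (intro iffI allI impI)
  obtain r R where r: "0 < r" "\<And>u. norm u = 1 \<Longrightarrow> r \<le> radial K u"
    using star_body_radial_bounds[OF K] by metis
  fix u :: "real^'n" assume A: "A \<in> enclosing_matrices K" and u: "norm u = 1"
  have "0 \<le> radial K u" using r u by fastforce
  moreover from this have "radial K u *\<^sub>R u \<in> K" using star_body_scaleR_mem_iff[OF K u] by simp
  ultimately show "radial K u * norm (A *v u) \<le> 1"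
    using A by (fastforce simp: enclosing_matrices_def norm_ellipsoid_def matrix_vector_mult_scaleR)
next
  assume A: "\<forall>u. norm u = 1 \<longrightarrow> radial K u * norm (A *v u) \<le> 1"
  have "norm (A *v x) \<le> 1" if "x \<in> K" for x
  proof (cases "x = 0")
    case False
    define u where "u = x /\<^sub>R norm x"
    have u: "norm u = 1" "x = norm x *\<^sub>R u" using False by (auto simp: u_def)
    then have "norm x \<le> radial K u" using star_body_scaleR_mem_iff[OF K u(1), of "norm x"] that by auto
    then have "norm x * norm (A *v u) \<le> radial K u * norm (A *v u)" by (rule mult_right_mono) simp
    also have "\<dots> \<le> 1" using A u(1) by blast
    also have "norm x * norm (A *v u) = norm (A *v x)"
      using False by (simp add: u_def matrix_vector_mult_scaleR)
    finally show ?thesis .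
  qed simp
  then show "A \<in> enclosing_matrices K" by (auto simp: enclosing_matrices_def norm_ellipsoid_def)
qed

lemma enclosing_subset_Orlicz_matrices:
  fixes K :: "(real^'n) set"
  assumes K: "K \<in> star_bodies" and \<phi>: "\<phi> \<in> Orlicz_class"
  shows "enclosing_matrices K \<subseteq> Orlicz_matrices \<phi> K"
proof
  fix A assume "A \<in> enclosing_matrices K"
  then have A: "\<And>u. norm u = 1 \<Longrightarrow> radial K u * norm (A *v u) \<le> 1"
    using enclosing_matrices_iff[OF K] by blast
  interpret finite_measure "dual_cone_measure K"
    using K by (rule finite_measure_dual_cone_measure)
  obtain r R where r: "0 < r" "\<And>u. norm u = 1 \<Longrightarrow> r \<le> radial K u"
    using star_body_radial_bounds[OF K] by metis
  have "Orlicz_mean \<phi> K A \<le> (\<integral>u. \<phi> 1 \<partial>dual_cone_measure K)"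
    unfolding Orlicz_mean_def
  proof (rule integral_mono)
    show "integrable (dual_cone_measure K) (\<lambda>u. \<phi> (radial K u * norm (A *v u)))"
      using K Orlicz_class_continuous[OF \<phi>] by (rule integrable_Orlicz_integrand)
    fix u assume "u \<in> space (dual_cone_measure K)"
    then have u: "norm u = 1" by simp
    have "0 \<le> radial K u" using r(1) r(2)[OF u] by simp
    then show "\<phi> (radial K u * norm (A *v u)) \<le> \<phi> 1"
      using A[OF u] by (intro Orlicz_class_mono[OF \<phi>]) auto
  qed simp
  also have "\<dots> = measure (dual_cone_measure K) (sphere 0 1) * \<phi> 1" by simp
  also have "\<dots> \<le> 1 * \<phi> 1"
    using measure_dual_cone_measure_le_one[OF K] Orlicz_class_one_pos[OF \<phi>]
    by (intro mult_right_mono) auto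
  finally show "A \<in> Orlicz_matrices \<phi> K" by (simp add: Orlicz_matrices_def)
qed

lemma compact_enclosing_matrices:
  fixes K :: "(real^'n) set"
  assumes K: "K \<in> star_bodies"
  shows "compact (enclosing_matrices K)"
proof -
  have "closed (enclosing_matrices K)"
    unfolding closed_sequential_limits
  proof (intro allI impI, elim conjE)
    fix X A assume X: "\<forall>n. X n \<in> enclosing_matrices K" "X \<longlonglongrightarrow> A"
    have "norm (A *v x) \<le> 1" if "x \<in> K" for x
    proof -
      have "(\<lambda>k. norm (X k *v x)) \<longlonglongrightarrow> norm (A *v x)"
        by (intro tendsto_intros tendsto_matrix_vector_mult X)
      then show ?thesis
        using X(1) that by (intro LIMSEQ_le_const2)
          (auto simp: enclosing_matrices_def norm_ellipsoid_def)
    qed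
    then show "A \<in> enclosing_matrices K" by (auto simp: enclosing_matrices_def norm_ellipsoid_def)
  qed
  \<comment> \<open>Boundedness is borrowed from the larger compact set belonging to the identity
    function.\<close>
  with compact_Orlicz_matrices[OF K Orlicz_class_id] enclosing_subset_Orlicz_matrices[OF K Orlicz_class_id]
  show ?thesis by (metis closed_Int_compact inf.absorb1)
qed

lemma enclosing_matrices_nonsingular:
  fixes K :: "(real^'n) set"
  assumes K: "K \<in> star_bodies"
  obtains A where "A \<in> enclosing_matrices K" "det A \<noteq> 0"
proof -
  obtain r R where R: "0 < R" "K \<subseteq> ball 0 R"
    using star_body_bounds[OF K] by metis
  let ?A = "mat (1 / R) :: real^'n^'n"
  have mv: "?A *v x = x /\<^sub>R R" for x
    by (simp add: vec_eq_iff mat_def matrix_vector_mult_def if_distrib[of "\<lambda>z. z * _"] divide_inverse cong: if_cong)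
  have "?A \<in> enclosing_matrices K"
    using R by (auto simp: enclosing_matrices_def norm_ellipsoid_def mv field_simps subset_eq less_imp_le)
  moreover have "det ?A \<noteq> 0"
    using R by (subst det_diagonal) (auto simp: mat_def)
  ultimately show thesis using that by blast
qed

lemma Orlicz_functional_integral:
  fixes K :: "(real^'n) set"
  assumes "det A \<noteq> 0" "l > 0"
  shows "(\<integral>u. \<phi> (radial K u / (l * radial (norm_ellipsoid A) u)) \<partial>dual_cone_measure K)
    = Orlicz_mean \<phi> K ((1 / l) *\<^sub>R A)"
  unfolding Orlicz_mean_def
proof (rule Bochner_Integration.integral_cong[OF refl])
  fix u assume "u \<in> space (dual_cone_measure K)"
  then have "u \<noteq> 0" by auto
  then show "\<phi> (radial K u / (l * radial (norm_ellipsoid A) u)) = \<phi> (radial K u * norm ((1 / l) *\<^sub>R A *v u))"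
    using assms by (simp add: radial_norm_ellipsoid scaleR_matrix_vector_assoc[symmetric])
qed

lemma Orlicz_mean_nonneg:
  fixes K :: "(real^'n) set"
  assumes K: "K \<in> star_bodies" and \<phi>: "\<phi> \<in> Orlicz_class"
  shows "0 \<le> Orlicz_mean \<phi> K A"
  using Orlicz_mean_ge[OF K \<phi> open_empty, of 0 A] by simp

text \<open>Scaling the ellipsoid by l divides A by l, so the infimum is over the l with A/l in the
  constraint set. These form an upward closed set, and closedness of the constraint set shows that
  an infimum of at most 1 makes l = 1 admissible.\<close>

lemma Orlicz_functional_le_one_iff:
  fixes K :: "(real^'n) set"
  assumes K: "K \<in> star_bodies" and \<phi>: "\<phi> \<in> Orlicz_class" and A: "det A \<noteq> 0"
  shows "Orlicz_functional \<phi> K (norm_ellipsoid A) \<le> 1 \<longleftrightarrow> A \<in> Orlicz_matrices \<phi> K"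
proof -
  define \<L> where "\<L> = {l. l > 0 \<and> (1 / l) *\<^sub>R A \<in> Orlicz_matrices \<phi> K}"
  have eq: "Orlicz_functional \<phi> K (norm_ellipsoid A) = Inf \<L>"
    unfolding Orlicz_functional_def \<L>_def Orlicz_matrices_def
    using inv_into_Orlicz_le_one_iff[OF \<phi> Orlicz_mean_nonneg[OF K \<phi>]] Orlicz_functional_integral[OF A]
    by (intro arg_cong[where f = Inf]) auto
  have bdd: "bdd_below \<L>" by (rule bdd_belowI[of _ 0]) (simp add: \<L>_def)
  obtain r R where rR: "0 < r" "\<And>u. norm u = 1 \<Longrightarrow> r \<le> radial K u" "\<And>u. norm u = 1 \<Longrightarrow> radial K u \<le> R"
    using star_body_radial_bounds[OF K] by metis
  have up: "l' \<in> \<L>" if l: "l \<in> \<L>" and le: "l \<le> l'" for l l'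
  proof -
    have pos: "0 < l" "0 < l'" using l le by (auto simp: \<L>_def)
    have int: "integrable (dual_cone_measure K) (\<lambda>u. \<phi> (radial K u * norm (B *v u)))" for B :: "real^'n^'n"
      using K Orlicz_class_continuous[OF \<phi>] by (rule integrable_Orlicz_integrand)
    have "Orlicz_mean \<phi> K ((1 / l') *\<^sub>R A) \<le> Orlicz_mean \<phi> K ((1 / l) *\<^sub>R A)"
      unfolding Orlicz_mean_def
    proof (rule integral_mono[OF int int])
      fix u assume "u \<in> space (dual_cone_measure K)"
      then have "0 \<le> radial K u" using rR by fastforce
      moreover have "norm ((1 / l') *\<^sub>R A *v u) \<le> norm ((1 / l) *\<^sub>R A *v u)"
        using pos le by (simp add: scaleR_matrix_vector_assoc[symmetric] divide_left_mono)
      ultimately show "\<phi> (radial K u * norm ((1 / l') *\<^sub>R A *v u)) \<le> \<phi> (radial K u * norm ((1 / l) *\<^sub>R A *v u))"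
        by (intro Orlicz_class_mono[OF \<phi>] mult_left_mono) auto
    qed
    then show ?thesis using l pos by (simp add: \<L>_def Orlicz_matrices_def)
  qed
  have ne: "\<L> \<noteq> {}"
  proof -
    \<comment> \<open>Large enough that A / l is enclosing, hence admissible; the summand 1 keeps l
      positive.\<close>
    define l where "l = 1 + R * norm A"
    have "0 \<le> R" using rR(1) rR(2,3)[of "axis undefined 1"] by simp
    then have l: "0 < l" by (simp add: l_def add_pos_nonneg)
    have "(1 / l) *\<^sub>R A \<in> enclosing_matrices K"
      unfolding enclosing_matrices_iff[OF K]
    proof (intro allI impI)
      fix u :: "real^'n" assume u: "norm u = 1"
      have "norm (A *v u) \<le> norm A" using norm_matrix_vector_mult_le[of A u] u by simp
      then have "radial K u * norm (A *v u) \<le> R * norm A"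
        using rR(3)[OF u] \<open>0 \<le> R\<close> by (intro mult_mono) auto
      then show "radial K u * norm ((1 / l) *\<^sub>R A *v u) \<le> 1"
        using l by (simp add: scaleR_matrix_vector_assoc[symmetric] l_def)
    qed
    then have "l \<in> \<L>" using enclosing_subset_Orlicz_matrices[OF K \<phi>] l by (auto simp: \<L>_def)
    then show ?thesis by blast
  qed
  show ?thesis
    unfolding eq
  proof
    assume "A \<in> Orlicz_matrices \<phi> K"
    then have "1 \<in> \<L>" by (simp add: \<L>_def)
    then show "Inf \<L> \<le> 1" using bdd by (rule cInf_lower)
  next
    assume le: "Inf \<L> \<le> 1"
    \<comment> \<open>An infimum equal to 1 gives no admissible l <= 1 directly, so 1 is approached
      from above.\<close>
    have "(1 / (1 + 1 / real (Suc k))) *\<^sub>R A \<in> Orlicz_matrices \<phi> K" for k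
    proof -
      have "Inf \<L> < 1 + 1 / real (Suc k)" using le by (rule le_less_trans) simp
      then obtain l where "l \<in> \<L>" "l < 1 + 1 / real (Suc k)"
        using cInf_lessD[OF ne] by blast
      then have "1 + 1 / real (Suc k) \<in> \<L>" using up by (meson less_imp_le)
      then show ?thesis by (simp add: \<L>_def)
    qed
    moreover have "(\<lambda>k. (1 / (1 + 1 / real (Suc k))) *\<^sub>R A) \<longlonglongrightarrow> (1 / (1 + 0)) *\<^sub>R A"
      using LIMSEQ_inverse_real_of_nat by (intro tendsto_intros) (auto simp: divide_inverse)
    moreover have "closed (Orlicz_matrices \<phi> K)"
      using compact_Orlicz_matrices[OF K \<phi>] by (rule compact_imp_closed)
    ultimately show "A \<in> Orlicz_matrices \<phi> K"
      using closed_sequentially[of "Orlicz_matrices \<phi> K"] by fastforce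
  qed
qed

text \<open>Volume is inversely proportional to |det A|, so minimal volume means maximal
  determinant, and \<open>max_det_unique\<close> gives the uniqueness that \<open>THE\<close>
  requires.\<close>

lemma Orlicz_Legendre_eq_norm_ellipsoid:
  fixes K :: "(real^'n) set"
  assumes K: "K \<in> star_bodies" and \<phi>: "\<phi> \<in> Orlicz_class" and A: "max_det (Orlicz_matrices \<phi> K) A"
  shows "Orlicz_Legendre_ellipsoid \<phi> K = norm_ellipsoid A"
  unfolding Orlicz_Legendre_ellipsoid_def
proof (rule the_equality, intro conjI ballI impI)
  note iff = Orlicz_functional_le_one_iff[OF K \<phi>]
  have detA: "det A \<noteq> 0" using A by (simp add: max_det_def)
  show E: "norm_ellipsoid A \<in> sym_ellipsoids"
    using detA by (rule norm_ellipsoid_sym_ellipsoid)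
  show feas: "Orlicz_functional \<phi> K (norm_ellipsoid A) \<le> 1"
    using A iff[OF detA] by (simp add: max_det_def)
  show "volume (norm_ellipsoid A) \<le> volume E'"
    if E': "E' \<in> sym_ellipsoids" "Orlicz_functional \<phi> K E' \<le> 1" for E' :: "(real^'n) set"
  proof -
    obtain B where B: "det B \<noteq> 0" "E' = norm_ellipsoid B"
      using sym_ellipsoid_norm_ellipsoid[OF E'(1)] .
    then show ?thesis
      using A E'(2) iff[OF B(1)] volume_norm_ellipsoid_le_iff[OF detA B(1)] by (auto simp: max_det_def)
  qed
  fix E assume E': "E \<in> sym_ellipsoids \<and> Orlicz_functional \<phi> K E \<le> 1 \<and>
    (\<forall>E'\<in>sym_ellipsoids. Orlicz_functional \<phi> K E' \<le> 1 \<longrightarrow> volume E \<le> volume E')"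
  then obtain B where B: "det B \<noteq> 0" "E = norm_ellipsoid B"
    using sym_ellipsoid_norm_ellipsoid by metis
  then have "B \<in> Orlicz_matrices \<phi> K" "\<bar>det A\<bar> \<le> \<bar>det B\<bar>"
    using E' E feas iff[OF B(1)] volume_norm_ellipsoid_le_iff[OF B(1) detA] by auto
  then have "norm (B *v x) = norm (A *v x)" for x
    using max_det_unique[OF mean_closed_Orlicz_matrices[OF K \<phi>] A] by blast
  then show "E = norm_ellipsoid A" unfolding B(2) norm_ellipsoid_def by simp
qed

section \<open>The limit\<close>

text \<open>If \<open>\<rho>\<^sub>K \<bar>A u\<bar> > 1\<close> somewhere, then \<open>\<rho>\<^sub>K \<bar>X\<^sub>k u\<bar> \<ge> t > 1\<close> on a fixed set of positive measure for large \<open>k\<close>,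
  and \<open>(\<phi> t / \<phi> 1)\<^sup>p\<close> outgrows every bound.\<close>

lemma Orlicz_matrices_limit_enclosing:
  fixes K :: "(real^'n) set" and X :: "nat \<Rightarrow> real^'n^'n"
  assumes K: "K \<in> star_bodies" and \<phi>: "\<phi> \<in> Orlicz_class"
    and p: "filterlim p at_top sequentially" "\<And>k. p k \<ge> 1"
    and X: "\<And>k. X k \<in> Orlicz_matrices (\<lambda>t. \<phi> t powr p k) K" "X \<longlonglongrightarrow> A"
  shows "A \<in> enclosing_matrices K"
  unfolding enclosing_matrices_iff[OF K]
proof (rule ccontr)
  assume "\<not> (\<forall>u. norm u = 1 \<longrightarrow> radial K u * norm (A *v u) \<le> 1)"
  then obtain u0 where u0: "norm u0 = 1" "1 < radial K u0 * norm (A *v u0)" by auto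
  interpret finite_measure "dual_cone_measure K"
    using K by (rule finite_measure_dual_cone_measure)
  obtain r R where rR: "0 < r" "\<And>u. norm u = 1 \<Longrightarrow> r \<le> radial K u" "\<And>u. norm u = 1 \<Longrightarrow> radial K u \<le> R"
    using star_body_radial_bounds[OF K] by metis
  obtain s where s: "1 < s" "s < radial K u0 * norm (A *v u0)" using dense[OF u0(2)] by blast
  \<comment> \<open>The level s cuts out the open set for the limit matrix; the gap s - t absorbs
    the change from A to \<open>X k\<close>.\<close>
  obtain t where t: "1 < t" "t < s" using dense[OF s(1)] by blast
  have "continuous_on (sphere 0 1) (\<lambda>u. radial K u * norm (A *v u))"
    using continuous_on_Orlicz_integrand[OF K continuous_on_id] .
  then have "openin (top_of_set (sphere 0 1)) (sphere 0 1 \<inter> (\<lambda>u. radial K u * norm (A *v u)) -` {s<..})"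
    by (rule continuous_openin_preimage_gen) simp
  then obtain U where U: "open U"
    "sphere 0 1 \<inter> (\<lambda>u. radial K u * norm (A *v u)) -` {s<..} = sphere 0 1 \<inter> U"
    unfolding openin_open by (elim exE conjE) (rule that)
  define m where "m = measure (dual_cone_measure K) (U \<inter> sphere 0 1)"
  have U_iff: "u \<in> U \<longleftrightarrow> s < radial K u * norm (A *v u)" if "norm u = 1" for u
  proof -
    have "u \<in> sphere 0 1 \<inter> U \<longleftrightarrow> u \<in> sphere 0 1 \<inter> (\<lambda>u. radial K u * norm (A *v u)) -` {s<..}"
      by (simp only: U(2))
    then show ?thesis using that by simp
  qed
  then have "u0 \<in> U" using u0(1) s(2) by blast
  then have "0 < emeasure (dual_cone_measure K) (U \<inter> sphere 0 1)"
    by (rule emeasure_dual_cone_measure_open_pos[OF K U(1) _ u0(1)])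
  then have m: "0 < m" by (simp add: m_def emeasure_eq_measure)
  define c where "c = \<phi> t / \<phi> 1"
  have pos1: "0 < \<phi> 1" using \<phi> by (rule Orlicz_class_one_pos)
  have "\<phi> 1 < \<phi> t" using t(1) by (intro Orlicz_class_less[OF \<phi>]) auto
  then have c: "1 < c" using pos1 by (simp add: c_def)
  have "(\<lambda>k. R * norm (X k - A)) \<longlonglongrightarrow> R * norm (A - A)"
    by (intro tendsto_intros X)
  then have "\<forall>\<^sub>F k in sequentially. R * norm (X k - A) < s - t"
    using t(2) by (intro order_tendstoD) auto
  \<comment> \<open>The threshold comes from c powr p >= p ln c: beyond it the Markov bound c powr p
    * m exceeds 1.\<close>
  moreover have "\<forall>\<^sub>F k in sequentially. 1 / (m * ln c) < p k"
    using p(1) by (auto simp: filterlim_at_top_dense)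
  ultimately have "\<forall>\<^sub>F k in sequentially. R * norm (X k - A) < s - t \<and> 1 / (m * ln c) < p k"
    by (rule eventually_conj)
  then obtain k where k: "R * norm (X k - A) < s - t" "1 / (m * ln c) < p k"
    using eventually_happens by fastforce
  have "t \<le> radial K u * norm (X k *v u)" if u: "u \<in> U" "norm u = 1" for u
  proof -
    have "0 \<le> radial K u" using rR(1) rR(2)[OF u(2)] by simp
    have "norm (A *v u) \<le> norm (X k *v u) + norm (X k - A)"
      using norm_triangle_ineq4[of "X k *v u" "(X k - A) *v u"] norm_matrix_vector_mult_le[of "X k - A" u] u(2)
      by (simp add: matrix_vector_mult_diff_rdistrib)
    then have "radial K u * norm (A *v u) \<le> radial K u * (norm (X k *v u) + norm (X k - A))"
      using \<open>0 \<le> radial K u\<close> by (rule mult_left_mono)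
    also have "\<dots> \<le> radial K u * norm (X k *v u) + R * norm (X k - A)"
      using rR(3)[OF u(2)] by (simp add: distrib_left mult_right_mono)
    finally have "radial K u * norm (A *v u) \<le> radial K u * norm (X k *v u) + R * norm (X k - A)" .
    moreover have "s < radial K u * norm (A *v u)" using U_iff u by blast
    ultimately show ?thesis using k(1) by linarith
  qed
  then have "\<phi> t powr p k * m \<le> Orlicz_mean (\<lambda>t. \<phi> t powr p k) K (X k)"
    unfolding m_def using t(1) by (intro Orlicz_mean_ge[OF K Orlicz_class_powr[OF \<phi> p(2)] U(1)]) auto
  also have "\<dots> \<le> \<phi> 1 powr p k" using X(1)[of k] by (simp add: Orlicz_matrices_def)
  finally have "c powr p k * m \<le> 1"
    using pos1 \<open>\<phi> 1 < \<phi> t\<close> by (simp add: c_def powr_divide divide_le_eq)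
  moreover have "p k * ln c * m \<le> c powr p k * m"
  proof (rule mult_right_mono)
    have "p k * ln c \<le> exp (p k * ln c)"
      using exp_ge_add_one_self[of "p k * ln c"] by linarith
    then show "p k * ln c \<le> c powr p k" using c by (simp add: powr_def)
  qed (use m in simp)
  ultimately have "p k * ln c * m \<le> 1" by linarith
  moreover have "1 < p k * (m * ln c)" using k(2) m c by (simp add: divide_less_eq)
  ultimately show False by (simp add: mult_ac)
qed

text \<open>The radial functions are 1/|X u| and 1/|A u|, whose difference is at most |X - A| / (|X
  u| |A u|) on the sphere. With m the minimum of |A u|, the denominator is at least m^2/2 once |X -
  A| < m/2.\<close>

lemma dual_Hausdorff_dist_norm_ellipsoid_tendsto:
  fixes X :: "nat \<Rightarrow> real^'n^'n"
  assumes X: "X \<longlonglongrightarrow> A" "\<And>k. det (X k) \<noteq> 0" and A: "det A \<noteq> 0"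
  shows "(\<lambda>k. dual_Hausdorff_dist (norm_ellipsoid (X k)) (norm_ellipsoid A)) \<longlonglongrightarrow> 0"
proof -
  let ?S = "sphere 0 1 :: (real^'n) set"
  let ?D = "\<lambda>k. dual_Hausdorff_dist (norm_ellipsoid (X k)) (norm_ellipsoid A)"
  have S: "?S \<noteq> {}" by simp
  have "continuous_on ?S (\<lambda>u. norm (A *v u))"
    by (intro continuous_on_norm matrix_vector_mult_linear_continuous_on)
  then obtain v where v: "v \<in> ?S" "\<And>u. u \<in> ?S \<Longrightarrow> norm (A *v v) \<le> norm (A *v u)"
    using continuous_attains_inf[OF compact_sphere S] by metis
  define m where "m = norm (A *v v)"
  have "v \<noteq> 0" using v(1) by auto
  then have m: "0 < m" unfolding m_def using A by (intro det_nz_norm_pos)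
  have "(\<lambda>k. norm (X k - A)) \<longlonglongrightarrow> norm (A - A)" by (intro tendsto_intros X)
  then have lim: "(\<lambda>k. norm (X k - A)) \<longlonglongrightarrow> 0" by simp
  then have ev: "\<forall>\<^sub>F k in sequentially. norm (X k - A) < m / 2"
    using m by (intro order_tendstoD) auto
  have bound: "\<bar>radial (norm_ellipsoid (X k)) u - radial (norm_ellipsoid A) u\<bar> \<le> 2 / m\<^sup>2 * norm (X k - A)"
    if k: "norm (X k - A) < m / 2" and u: "u \<in> ?S" for k u
  proof -
    let ?x = "norm (X k *v u)" and ?a = "norm (A *v u)"
    have u': "norm u = 1" "u \<noteq> 0" using u by auto
    have a: "m \<le> ?a" using v(2)[OF u] by (simp add: m_def)
    have "\<bar>?a - ?x\<bar> \<le> norm (A *v u - X k *v u)" by (rule norm_triangle_ineq3)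
    also have "\<dots> = norm ((X k - A) *v u)"
      by (simp add: matrix_vector_mult_diff_rdistrib norm_minus_commute)
    also have "\<dots> \<le> norm (X k - A)" using norm_matrix_vector_mult_le[of "X k - A" u] u' by simp
    finally have diff: "\<bar>?a - ?x\<bar> \<le> norm (X k - A)" .
    then have x: "m / 2 \<le> ?x" using a k by linarith
    have "m / 2 * m \<le> ?x * ?a" using x a m by (intro mult_mono) auto
    then have xa: "m\<^sup>2 / 2 \<le> ?x * ?a" by (simp add: power2_eq_square)
    have "radial (norm_ellipsoid (X k)) u - radial (norm_ellipsoid A) u = (?a - ?x) / (?x * ?a)"
    proof -
      have "?x \<noteq> 0" "?a \<noteq> 0" using x a m by linarith+
      then show ?thesis
        unfolding radial_norm_ellipsoid[OF X(2) u'(2)] radial_norm_ellipsoid[OF A u'(2)]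
        by (simp add: diff_divide_distrib)
    qed
    then have "\<bar>radial (norm_ellipsoid (X k)) u - radial (norm_ellipsoid A) u\<bar> = \<bar>?a - ?x\<bar> / (?x * ?a)"
      by (simp add: abs_mult)
    also have "\<dots> \<le> norm (X k - A) / (m\<^sup>2 / 2)"
      using diff xa m by (intro frac_le) auto
    finally show ?thesis by (simp add: mult.commute)
  qed
  have up: "?D k \<le> 2 / m\<^sup>2 * norm (X k - A)" if "norm (X k - A) < m / 2" for k
    unfolding dual_Hausdorff_dist_def using S bound[OF that] by (intro cSUP_least) auto
  \<comment> \<open>A real \<open>SUP\<close> is meaningful only for a set bounded above, so even
    nonnegativity is shown only where the uniform bound is available.\<close>
  have low: "0 \<le> ?D k" if "norm (X k - A) < m / 2" for k
  proof -
    have "bdd_above ((\<lambda>u. \<bar>radial (norm_ellipsoid (X k)) u - radial (norm_ellipsoid A) u\<bar>) ` ?S)"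
      using bound[OF that] by (intro bdd_aboveI2)
    then have "\<bar>radial (norm_ellipsoid (X k)) v - radial (norm_ellipsoid A) v\<bar> \<le> ?D k"
      unfolding dual_Hausdorff_dist_def using v(1) by (intro cSUP_upper)
    then show ?thesis by linarith
  qed
  have "(\<lambda>k. 2 / m\<^sup>2 * norm (X k - A)) \<longlonglongrightarrow> 2 / m\<^sup>2 * 0" by (intro tendsto_intros lim)
  then have lim': "(\<lambda>k. 2 / m\<^sup>2 * norm (X k - A)) \<longlonglongrightarrow> 0" by simp
  show ?thesis
  proof (rule tendsto_sandwich[OF _ _ tendsto_const lim'])
    show "\<forall>\<^sub>F k in sequentially. 0 \<le> ?D k"
      using ev by eventually_elim (rule low)
    show "\<forall>\<^sub>F k in sequentially. ?D k \<le> 2 / m\<^sup>2 * norm (X k - A)"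
      using ev by eventually_elim (rule up)
  qed
qed

theorem theorem6p4:
  fixes K :: "(real^'n) set" and \<phi> :: "real \<Rightarrow> real"
  assumes "K \<in> star_bodies" and "\<phi> \<in> Orlicz_class"
  shows "((\<lambda>p::real. dual_Hausdorff_dist
            (Orlicz_Legendre_ellipsoid (\<lambda>t. \<phi> t powr p) K) (L_infinity_ellipsoid K))
          \<longlongrightarrow> 0) at_top"
proof (rule ccontr)
  note K = assms(1) and \<phi> = assms(2)
  define D where "D p = dual_Hausdorff_dist (Orlicz_Legendre_ellipsoid (\<lambda>t. \<phi> t powr p) K)
    (L_infinity_ellipsoid K)" for p
  obtain A0 where A0: "max_det (enclosing_matrices K) A0"
    using enclosing_matrices_nonsingular[OF K] max_det_exists[OF compact_enclosing_matrices[OF K]] by metis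
  assume "\<not> ?thesis"
  then have "\<not> (D \<longlongrightarrow> 0) at_top" by (simp add: D_def[abs_def])
  then obtain e where e: "e > 0" "\<not> (\<forall>\<^sub>F p in at_top. dist (D p) 0 < e)"
    unfolding tendsto_iff by blast
  then have "\<exists>p\<ge>N. e \<le> \<bar>D p\<bar>" for N
    unfolding eventually_at_top_linorder by (auto simp: not_less)
  \<comment> \<open>The bound k + 1 makes the chosen exponents tend to infinity and also keeps them
    at least 1, so that every power stays in \<open>Orlicz_class\<close>.\<close>
  then have "\<forall>k. \<exists>p. real (Suc k) \<le> p \<and> e \<le> \<bar>D p\<bar>" by blast
  from choice[OF this] obtain p where p: "\<And>k. real (Suc k) \<le> p k" "\<And>k. e \<le> \<bar>D (p k)\<bar>"
    by blast
  have p1: "1 \<le> p k" for k using p(1)[of k] by simp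
  have p_lim: "filterlim p at_top sequentially"
    using p(1) by (intro filterlim_at_top_mono[OF filterlim_real_sequentially])
      (auto intro!: always_eventually order_trans[OF _ p(1)])
  have \<phi>p: "(\<lambda>t. \<phi> t powr p k) \<in> Orlicz_class" for k using \<phi> p1 by (rule Orlicz_class_powr)
  have A0_mem: "A0 \<in> Orlicz_matrices (\<lambda>t. \<phi> t powr p k) K" for k
    using A0 enclosing_subset_Orlicz_matrices[OF K \<phi>p] by (auto simp: max_det_def)
  have "\<exists>A. max_det (Orlicz_matrices (\<lambda>t. \<phi> t powr p k) K) A" for k
  proof -
    have "det A0 \<noteq> 0" using A0 by (simp add: max_det_def)
    then obtain A where "max_det (Orlicz_matrices (\<lambda>t. \<phi> t powr p k) K) A"
      by (rule max_det_exists[OF compact_Orlicz_matrices[OF K \<phi>p] A0_mem])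
    then show ?thesis ..
  qed
  then obtain X where X: "\<And>k. max_det (Orlicz_matrices (\<lambda>t. \<phi> t powr p k) K) (X k)" by metis
  then have X_mem: "X k \<in> Orlicz_matrices (\<lambda>t. \<phi> t powr p k) K" and X_det: "det (X k) \<noteq> 0" for k
    by (auto simp: max_det_def)
  have X_ge: "\<bar>det A0\<bar> \<le> \<bar>det (X k)\<bar>" for k
    using X[of k] A0_mem[of k] by (simp add: max_det_def)
  obtain R where "\<And>k. norm (X k) \<le> R"
    using Orlicz_matrices_bounded[OF K] \<phi>p X_mem by metis
  then have "\<forall>k. X k \<in> cball 0 R" by simp
  then obtain A r where Ar: "strict_mono r" "(X \<circ> r) \<longlonglongrightarrow> A"
    using compact_cball[of "0 :: real^'n^'n" R] unfolding compact_def by blast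
  have A: "A \<in> enclosing_matrices K"
  proof (rule Orlicz_matrices_limit_enclosing[OF K \<phi>])
    show "filterlim (p \<circ> r) at_top sequentially"
      unfolding o_def using p_lim filterlim_subseq[OF Ar(1)] by (rule filterlim_compose)
  qed (use p1 X_mem Ar(2) in auto)
  have "(\<lambda>k. \<bar>det ((X \<circ> r) k)\<bar>) \<longlonglongrightarrow> \<bar>det A\<bar>"
    by (intro tendsto_rabs continuous_on_tendsto_compose[OF continuous_on_det[of UNIV] Ar(2)]) auto
  \<comment> \<open>\<open>A0\<close> competes in every constraint set, so its determinant is a
    lower bound along the sequence. In the limit this both excludes a singular A and makes A a
    maximiser among enclosing matrices.\<close>
  then have "\<bar>det A0\<bar> \<le> \<bar>det A\<bar>" using X_ge by (intro LIMSEQ_le_const) auto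
  moreover from this have "det A \<noteq> 0" using A0 by (auto simp: max_det_def)
  \<comment> \<open>A itself depends on the subsequence and on the choice of the \<open>X k\<close>;
    only its norm function, hence its ellipsoid, is forced.\<close>
  ultimately have "norm_ellipsoid A = norm_ellipsoid A0"
    using max_det_unique[OF mean_closed_enclosing A0 A] by (simp add: norm_ellipsoid_def)
  then have "D (p (r k)) = dual_Hausdorff_dist (norm_ellipsoid ((X \<circ> r) k)) (norm_ellipsoid A)" for k
    using Orlicz_Legendre_eq_norm_ellipsoid[OF K \<phi>p X] L_infinity_eq_norm_ellipsoid[OF A0] by (simp add: D_def)
  moreover have "(\<lambda>k. dual_Hausdorff_dist (norm_ellipsoid ((X \<circ> r) k)) (norm_ellipsoid A)) \<longlonglongrightarrow> 0"
    by (rule dual_Hausdorff_dist_norm_ellipsoid_tendsto[OF Ar(2) _ \<open>det A \<noteq> 0\<close>]) (simp add: X_det)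
  ultimately have "(\<lambda>k. \<bar>D (p (r k))\<bar>) \<longlonglongrightarrow> 0" by (simp add: tendsto_rabs_zero_iff)
  then have "e \<le> 0" using p(2) by (intro LIMSEQ_le_const) auto
  with e(1) show False by simp
qed

end
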